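(* Let $M_n=\max_{1\le i\le n}X_i$ be the maximum of $n$ zero-mean jointly Gaussian random variables $X_1,\dots,X_n$ whose covariance matrix has minimum eigenvalue $\lambda$ and maximum eigenvalue $\Lambda$. Then, for $n\ge 70$, $$\Pr\left\{M_n\ge \lambda^{1/2}\left(2\log n-2.5-\log(2\log n-2.5)\right)^{1/2}-0.68\,\Lambda^{1/2}\right\}\ge \frac12 .$$
   Context: $\log$ is the natural logarithm. *)

theory Defs
  imports "HOL-Probability.Probability" "Jordan_Normal_Form.Char_Poly"
begin

(* The almost surely constant case is the normal law with variance 0, which has no density. *)
definition gaussian_rv :: "'a measure \<Rightarrow> ('a \<Rightarrow> real) \<Rightarrow> bool" where
  "gaussian_rv M Y \<longleftrightarrow> Y \<in> borel_measurable M \<and>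
     (\<exists>\<mu> \<sigma>. (0 < \<sigma> \<and> distributed M lborel Y (normal_density \<mu> \<sigma>)) \<or> (AE \<omega> in M. Y \<omega> = \<mu>))"

(* Joint Gaussianity: all finite linear combinations are univariate Gaussian.  No density on
   R^n is required, so singular covariance matrices are allowed.  Singleton combinations show
   that each X i is itself a (measurable) Gaussian random variable. *)
definition jointly_gaussian :: "'a measure \<Rightarrow> 'i set \<Rightarrow> ('i \<Rightarrow> 'a \<Rightarrow> real) \<Rightarrow> bool" where
  "jointly_gaussian M I X \<longleftrightarrow>
     (\<forall>J a. finite J \<and> J \<subseteq> I \<longrightarrow> gaussian_rv M (\<lambda>\<omega>. \<Sum>i\<in>J. a i * X i \<omega>))"

definition covariance :: "'a measure \<Rightarrow> ('a \<Rightarrow> real) \<Rightarrow> ('a \<Rightarrow> real) \<Rightarrow> real" where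
  "covariance M Y Z =
     (\<integral>\<omega>. (Y \<omega> - (\<integral>\<omega>'. Y \<omega>' \<partial>M)) * (Z \<omega> - (\<integral>\<omega>'. Z \<omega>' \<partial>M)) \<partial>M)"

(* Matrix.mat is qualified because HOL-Analysis has a different constant named mat. *)
definition covariance_matrix :: "'a measure \<Rightarrow> nat \<Rightarrow> (nat \<Rightarrow> 'a \<Rightarrow> real) \<Rightarrow> real Matrix.mat" where
  "covariance_matrix M n X = Matrix.mat n n (\<lambda>(i, j). covariance M (X i) (X j))"

definition min_eigenvalue :: "real Matrix.mat \<Rightarrow> real \<Rightarrow> bool" where
  "min_eigenvalue A l \<longleftrightarrow> eigenvalue A l \<and> (\<forall>k. eigenvalue A k \<longrightarrow> l \<le> k)"

definition max_eigenvalue :: "real Matrix.mat \<Rightarrow> real \<Rightarrow> bool" where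
  "max_eigenvalue A l \<longleftrightarrow> eigenvalue A l \<and> (\<forall>k. eigenvalue A k \<longrightarrow> k \<le> l)"

end

(* Let C be the covariance matrix.  As C - lam I is positive semidefinite, it is a Gram matrix
   B B^T, so X has the law of sqrt lam Z + B G with independent standard normal vectors Z and G,
   and the coordinates of B G have variances C_ii - lam <= Lam.  Let t be the first square root
   in the threshold.  The Mills ratio bound gives P(max Z >= t) >= 2/3.  Given Z with maximum
   at I and Z_I >= t, independence and the quartile estimate Phi(0.68) >= 3/4 show that
   (B G)_I >= -0.68 sqrt Lam with probability at least 3/4, and 2/3 * 3/4 = 1/2. *)
theory Submission
  imports Defs
begin

section \<open>Quadratic forms and eigenvalues\<close>

text \<open>The covariance may be singular, so \<open>X\<close> need not have a density, and joint
  Gaussianity only controls the laws of the linear combinations. The identity in law is therefore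
  reached by a Cramer-Wold argument, and just for boxes: that the maximum stays below a constant is
  a box event.

  No diagonalisation is involved. The Gram factor comes from Schur complements, and the extreme
  eigenvalues are linked to the quadratic form through a minimiser on the sphere.

  On the constants: 0.68 lies slightly above the upper quartile 0.6745 of the standard normal law.
  The bound 2/3 for the maximum of independent variables amounts to \<open>(1 - p) ^ n\<close> being
  at most 1/3, which holds once \<open>n * p\<close> exceeds ln 3, about 1.0986. The 2.5 in the
  threshold contributes a factor \<open>exp 1.25\<close> to \<open>n * p\<close>, the inner
  logarithm pays for the factor 1/t in the Mills ratio, and \<open>n\<close> at least 70 makes t at
  least 2; together they give \<open>n * p\<close> at least 1.1.\<close>

definition quad_form :: "nat \<Rightarrow> (nat \<Rightarrow> nat \<Rightarrow> real) \<Rightarrow> (nat \<Rightarrow> real) \<Rightarrow> real" where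
  "quad_form n A x = (\<Sum>i<n. \<Sum>j<n. A i j * x i * x j)"

lemma quad_form_Suc:
  assumes "\<And>i. i < n \<Longrightarrow> A n i = A i n"
  shows "quad_form (Suc n) A x
    = quad_form n A x + 2 * x n * (\<Sum>i<n. A i n * x i) + A n n * (x n)\<^sup>2"
proof -
  have "(\<Sum>i<n. A n i * x n * x i) = x n * (\<Sum>i<n. A i n * x i)"
    using assms by (simp add: sum_distrib_left mult_ac)
  moreover have "(\<Sum>i<n. A i n * x i * x n) = x n * (\<Sum>i<n. A i n * x i)"
    by (simp add: sum_distrib_left mult_ac)
  ultimately show ?thesis
    by (simp add: quad_form_def sum.distrib power2_eq_square algebra_simps)
qed

lemma quad_form_cong:
  assumes "\<And>i. i < n \<Longrightarrow> x i = y i"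
  shows "quad_form n A x = quad_form n A y"
  unfolding quad_form_def using assms by (intro sum.cong) auto

lemma quad_form_scale: "quad_form n A (\<lambda>i. c * x i) = c\<^sup>2 * quad_form n A x"
  by (simp add: quad_form_def sum_distrib_left power2_eq_square mult_ac)

lemma quad_form_gram:
  assumes "\<And>i j. i < n \<Longrightarrow> j < n \<Longrightarrow> A i j = (\<Sum>k<m. B i k * B j k)"
  shows "quad_form n A x = (\<Sum>k<m. (\<Sum>i<n. x i * B i k)\<^sup>2)"
proof -
  have "quad_form n A x = (\<Sum>i<n. \<Sum>j<n. \<Sum>k<m. (x i * B i k) * (x j * B j k))"
    unfolding quad_form_def using assms
    by (intro sum.cong) (auto simp: sum_distrib_left sum_distrib_right mult_ac)
  also have "\<dots> = (\<Sum>k<m. \<Sum>i<n. \<Sum>j<n. (x i * B i k) * (x j * B j k))"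
    by (subst sum.swap, subst (2) sum.swap, subst sum.swap) (rule sum.cong, simp, rule sum.swap)
  finally show ?thesis
    by (simp add: power2_eq_square sum_product)
qed

lemma linear_nonneg_imp_slope_zero:
  fixes a b :: real
  assumes "\<And>s. 0 \<le> a + s * b"
  shows "b = 0"
proof (rule ccontr)
  assume "b \<noteq> 0"
  then show False
    \<comment> \<open>This \<open>s\<close> gives the affine function the value -1.\<close>
    using assms[of "- (a + 1) / b"] by simp
qed

text \<open>A Cholesky factorisation that tolerates zero pivots: completing the square in the last
  variable leaves a positive semidefinite form in the others, to which the induction hypothesis
  applies.\<close>

theorem psd_imp_gram:
  assumes "\<And>i j. i < n \<Longrightarrow> j < n \<Longrightarrow> A i j = A j i"
    and "\<And>x. 0 \<le> quad_form n A x"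
  shows "\<exists>B. \<forall>i<n. \<forall>j<n. A i j = (\<Sum>k<n. B i k * B j k)"
  using assms
proof (induction n arbitrary: A)
  case 0
  then show ?case by simp
next
  case (Suc n)
  define d where "d = A n n"
  have qS: "quad_form (Suc n) A x
      = quad_form n A x + 2 * x n * (\<Sum>i<n. A i n * x i) + d * (x n)\<^sup>2" for x
    unfolding d_def using Suc.prems(1) by (intro quad_form_Suc) auto
  have d0: "0 \<le> d"
    using Suc.prems(2)[of "\<lambda>i. if i = n then 1 else 0"]
    unfolding qS by (simp add: quad_form_def)
  \<comment> \<open>Along the line e_i + s e_n the form is affine in \<open>s\<close> when
    \<open>d = 0\<close>, with slope \<open>2 * A i n\<close>; being nonnegative for every
    \<open>s\<close>, it has slope 0.\<close>
  have col: "A i n = 0" if "d = 0" "i < n" for i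
  proof -
    define e where "e s = (\<lambda>j. if j = n then s else if j = i then 1 else (0::real))" for s
    have "(\<Sum>j<n. A j n * e s j) = A i n" for s
    proof -
      have "(\<Sum>j<n. A j n * e s j) = (\<Sum>j<n. if j = i then A i n else 0)"
        using that by (intro sum.cong) (auto simp: e_def)
      then show ?thesis using that by simp
    qed
    moreover define c where "c = quad_form n A (e 0)"
    moreover have "quad_form n A (e s) = c" for s
      unfolding c_def by (rule quad_form_cong) (simp add: e_def)
    moreover have "e s n = s" for s by (simp add: e_def)
    ultimately have "0 \<le> c + s * (2 * A i n)" for s
      using Suc.prems(2)[of "e s"] unfolding qS using that by (simp add: mult_ac)
    then show ?thesis
      using linear_nonneg_imp_slope_zero by fastforce
  qed
  \<comment> \<open>Schur complement; if the pivot \<open>d\<close> vanishes then so does its column, and \<open>x / 0 = 0\<close>.\<close>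
  define A' where "A' i j = A i j - A i n * A j n / d" for i j
  have "0 \<le> quad_form n A' x" for x
  proof -
    define S where "S = (\<Sum>i<n. A i n * x i)"
    have "(\<Sum>i<n. \<Sum>j<n. A i n * A j n / d * x i * x j) = S\<^sup>2 / d"
      unfolding S_def power2_eq_square sum_product
      by (simp add: sum_divide_distrib mult_ac)
    then have "quad_form n A' x = quad_form n A x - S\<^sup>2 / d"
      by (simp add: quad_form_def A'_def left_diff_distrib sum_subtractf)
    \<comment> \<open>For positive \<open>d\<close>, the value \<open>- S / d\<close> of the last
      variable minimises the form, and completing the square yields the Schur complement. For
      \<open>d = 0\<close> it is 0 and both corrections vanish.\<close>
    also have "\<dots> = quad_form (Suc n) A (x(n := - S / d))"
    proof -
      have "quad_form n A (x(n := - S / d)) = quad_form n A x"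
        by (rule quad_form_cong) simp
      moreover have "(\<Sum>i<n. A i n * (x(n := - S / d)) i) = S"
        unfolding S_def by (intro sum.cong) auto
      ultimately show ?thesis
        unfolding qS by (cases "d = 0") (simp_all add: power2_eq_square field_simps)
    qed
    finally show ?thesis using Suc.prems(2) by simp
  qed
  moreover have "A' i j = A' j i" if "i < n" "j < n" for i j
    using that Suc.prems(1) by (simp add: A'_def)
  ultimately obtain B where B: "\<And>i j. i < n \<Longrightarrow> j < n \<Longrightarrow> A' i j = (\<Sum>k<n. B i k * B j k)"
    using Suc.IH[of A'] by blast
  \<comment> \<open>The new column restores the rank one term that was subtracted in
    \<open>A'\<close>; the new row is zero outside that column.\<close>
  define C where "C i k = (if k = n then A i n / sqrt d else if i < n then B i k else 0)" for i k
  have "A i j = (\<Sum>k<Suc n. C i k * C j k)" if ij: "i < Suc n" "j < Suc n" for i j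
  proof -
    have last: "C i n * C j n = A i n * A j n / d"
      using d0 by (simp add: C_def)
    show ?thesis
    proof (cases "i < n \<and> j < n")
      case True
      then have "(\<Sum>k<n. C i k * C j k) = A' i j"
        using B by (simp add: C_def)
      then show ?thesis using last by (simp add: A'_def)
    next
      case False
      then have "(\<Sum>k<n. C i k * C j k) = 0"
        by (auto simp: C_def intro!: sum.neutral)
      moreover have "A i n * A j n / d = A i j"
        using False ij col Suc.prems(1)[of i j]
        by (cases "d = 0") (auto simp: d_def less_Suc_eq)
      ultimately show ?thesis using last by simp
    qed
  qed
  then show ?case by blast
qed

text \<open>With A = B B^T the form is |B^T x|^2, so its vanishing gives B^T x = 0 and hence A x =
  0. Applied to A - m I at a minimiser, this takes the place of a Lagrange multiplier
  argument.\<close>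

lemma psd_form_zero_imp_kernel:
  assumes "\<And>i j. i < n \<Longrightarrow> j < n \<Longrightarrow> A i j = A j i"
    and "\<And>x. 0 \<le> quad_form n A x"
    and "quad_form n A x = 0" and "i < n"
  shows "(\<Sum>j<n. A i j * x j) = 0"
proof -
  obtain B where B: "\<And>i j. i < n \<Longrightarrow> j < n \<Longrightarrow> A i j = (\<Sum>k<n. B i k * B j k)"
    using psd_imp_gram[OF assms(1,2)] by blast
  have "(\<Sum>k<n. (\<Sum>i<n. x i * B i k)\<^sup>2) = 0"
    using assms(3) quad_form_gram[OF B] by simp
  then have z: "(\<Sum>i<n. x i * B i k) = 0" if "k < n" for k
    using that by (subst (asm) sum_nonneg_eq_0_iff) auto
  have "(\<Sum>j<n. A i j * x j) = (\<Sum>j<n. \<Sum>k<n. B i k * (x j * B j k))"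
    using B assms(4) by (simp add: sum_distrib_right sum_distrib_left mult_ac)
  also have "\<dots> = (\<Sum>k<n. B i k * (\<Sum>j<n. x j * B j k))"
    by (subst sum.swap) (simp add: sum_distrib_left)
  finally show ?thesis using z by simp
qed

section \<open>Extreme eigenvalues as bounds for the quadratic form\<close>

lemma quad_form_shift:
  "quad_form n (\<lambda>i j. A i j - (if i = j then m else 0)) x = quad_form n A x - m * (\<Sum>i<n. (x i)\<^sup>2)"
proof -
  have "(\<Sum>i<n. \<Sum>j<n. (if i = j then m else 0) * x i * x j) = (\<Sum>i<n. m * (x i)\<^sup>2)"
    by (intro sum.cong) (auto simp: if_distrib[of "\<lambda>z. z * _"] power2_eq_square cong: if_cong)
  then show ?thesis
    by (simp add: quad_form_def left_diff_distrib sum_subtractf sum_distrib_left)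
qed

text \<open>Compactness gives a minimiser on the unit sphere, and homogeneity of degree 2 extends
  the inequality to every \<open>y\<close>.\<close>

lemma quad_form_attains_min_on_sphere:
  assumes "0 < n"
  obtains x where "(\<Sum>i<n. (x i)\<^sup>2) = 1"
    and "\<And>y. quad_form n A x * (\<Sum>i<n. (y i)\<^sup>2) \<le> quad_form n A y"
proof -
  let ?N = "\<lambda>x::nat \<Rightarrow> real. \<Sum>i<n. (x i)\<^sup>2"
  \<comment> \<open>Points are functions on all naturals. Pinning the coordinates from
    \<open>n\<close> on to 0 makes \<open>K\<close> a product of compact sets, hence compact by
    Tychonoff.\<close>
  define K where "K = PiE UNIV (\<lambda>i. if i < n then {-1..1} else {0::real})"
  define S where "S = K \<inter> ?N -` {1}"
  have "compactin (product_topology (\<lambda>i. euclidean) UNIV) K"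
    unfolding K_def compactin_PiE by (auto simp: compactin_euclidean_iff)
  then have "compact K"
    by (simp add: euclidean_product_topology)
  moreover have "closed (?N -` {1})"
    by (intro closed_vimage continuous_intros) auto
  ultimately have "compact S"
    unfolding S_def by (rule compact_Int_closed)
  moreover have "(\<lambda>i. if i = 0 then 1 else 0) \<in> S"
  proof -
    have "(\<Sum>i<n. (if i = 0 then 1 else 0 :: real)\<^sup>2) = (\<Sum>i<n. if i = 0 then 1 else 0)"
      by (intro sum.cong) auto
    then show ?thesis using assms by (auto simp: S_def K_def)
  qed
  moreover have "continuous_on S (quad_form n A)"
    unfolding quad_form_def
    by (intro continuous_intros continuous_on_subset[OF continuous_on_product_coordinates]) auto
  ultimately obtain x where x: "x \<in> S" "\<And>y. y \<in> S \<Longrightarrow> quad_form n A x \<le> quad_form n A y"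
    using continuous_attains_inf[of S "quad_form n A"] by blast
  have "quad_form n A x * ?N y \<le> quad_form n A y" for y
  proof (cases "?N y = 0")
    case True
    then have "\<And>i. i < n \<Longrightarrow> y i = 0"
      by (subst (asm) sum_nonneg_eq_0_iff) auto
    then have "quad_form n A y = 0"
      by (simp add: quad_form_def)
    then show ?thesis using True by simp
  next
    case False
    then have pos: "0 < ?N y"
      by (metis less_eq_real_def sum_nonneg zero_le_power2)
    define c where "c = 1 / sqrt (?N y)"
    have c2: "c\<^sup>2 = 1 / ?N y"
      using pos by (simp add: c_def power_divide)
    \<comment> \<open>The normalised \<open>y\<close>, cut off beyond \<open>n\<close> so that it
      lies in \<open>K\<close>; the form does not see the cut.\<close>
    define z where "z i = (if i < n then c * y i else 0)" for i
    have qz: "quad_form n A z = c\<^sup>2 * quad_form n A y"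
      using quad_form_cong[of n z "\<lambda>i. c * y i" A] quad_form_scale[of n A c y]
      by (simp add: z_def)
    have "?N z = c\<^sup>2 * ?N y"
      by (simp add: z_def sum_distrib_left power_mult_distrib)
    then have Nz: "?N z = 1"
      using c2 pos by simp
    have "\<bar>z i\<bar> \<le> 1" if "i < n" for i
    proof -
      have "(z i)\<^sup>2 \<le> ?N z"
        using that by (intro member_le_sum) auto
      then show ?thesis
        using Nz by (simp add: abs_square_le_1)
    qed
    then have "z \<in> S"
      using Nz by (auto simp: S_def K_def z_def abs_le_iff minus_le_iff)
    then have "quad_form n A x \<le> c\<^sup>2 * quad_form n A y"
      using x(2) qz by metis
    then show ?thesis
      using pos by (simp add: c2 field_simps)
  qed
  moreover have "?N x = 1"
    using x(1) by (simp add: S_def)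
  ultimately show thesis using that by blast
qed

text \<open>Translates the eigenvalues of the definitions into finite sums over index functions, the
  language of \<open>quad_form\<close>.\<close>

lemma eigenvalue_mat_iff:
  "eigenvalue (Matrix.mat n n (\<lambda>(i, j). A i j)) k
    \<longleftrightarrow> (\<exists>x. (\<exists>i<n. x i \<noteq> 0) \<and> (\<forall>i<n. (\<Sum>j<n. A i j * x j) = k * x i))"
  (is "?L \<longleftrightarrow> ?R")
proof
  let ?A = "Matrix.mat n n (\<lambda>(i, j). A i j)"
  have prod: "(?A *\<^sub>v v) $ i = (\<Sum>j<n. A i j * v $ j)" if "v \<in> carrier_vec n" "i < n" for v i
    using that by (auto simp: scalar_prod_def atLeast0LessThan intro!: sum.cong)
  {
    assume ?L
    then obtain v where v: "v \<in> carrier_vec n" "v \<noteq> 0\<^sub>v n" "?A *\<^sub>v v = k \<cdot>\<^sub>v v"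
      unfolding eigenvalue_def eigenvector_def by auto
    from v(1,2) have "\<exists>i<n. v $ i \<noteq> 0"
      by (metis carrier_vecD eq_vecI index_zero_vec)
    moreover have "(\<Sum>j<n. A i j * v $ j) = k * v $ i" if "i < n" for i
      using prod[OF v(1) that] v that by simp
    ultimately show ?R by blast
  next
    assume ?R
    then obtain x where x: "\<exists>i<n. x i \<noteq> 0" "\<And>i. i < n \<Longrightarrow> (\<Sum>j<n. A i j * x j) = k * x i"
      by blast
    define v where "v = Matrix.vec n x"
    have "v \<in> carrier_vec n" by (simp add: v_def)
    moreover have "v \<noteq> 0\<^sub>v n"
      using x(1) unfolding v_def by (metis index_vec index_zero_vec(1))
    moreover have "?A *\<^sub>v v = k \<cdot>\<^sub>v v"
    proof (rule eq_vecI)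
      fix i assume "i < dim_vec (k \<cdot>\<^sub>v v)"
      then have "i < n" by (simp add: v_def)
      then show "(?A *\<^sub>v v) $ i = (k \<cdot>\<^sub>v v) $ i"
        using prod[of v i] x(2) by (simp add: v_def)
    qed (simp add: v_def)
    ultimately show ?L
      unfolding eigenvalue_def eigenvector_def by (intro exI[of _ v]) simp
  }
qed

text \<open>Let m be the minimum of the form on the sphere, attained at \<open>u\<close>. Then A - m
  I is positive semidefinite and its form vanishes at \<open>u\<close>, so \<open>u\<close> is in
  its kernel. Thus m is itself an eigenvalue and is at least \<open>l\<close>.\<close>

theorem eigenvalue_lower_bound_quad_form:
  fixes A :: "nat \<Rightarrow> nat \<Rightarrow> real"
  assumes sym: "\<And>i j. i < n \<Longrightarrow> j < n \<Longrightarrow> A i j = A j i"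
    and ev: "\<And>k. eigenvalue (Matrix.mat n n (\<lambda>(i, j). A i j)) k \<Longrightarrow> l \<le> k"
  shows "l * (\<Sum>i<n. (x i)\<^sup>2) \<le> quad_form n A x"
proof (cases "n = 0")
  case True
  then show ?thesis by (simp add: quad_form_def)
next
  case False
  then obtain u where u: "(\<Sum>i<n. (u i)\<^sup>2) = 1"
    and min: "\<And>y. quad_form n A u * (\<Sum>i<n. (y i)\<^sup>2) \<le> quad_form n A y"
    using quad_form_attains_min_on_sphere by blast
  define m where "m = quad_form n A u"
  let ?A = "Matrix.mat n n (\<lambda>(i, j). A i j)"
  have "(\<Sum>j<n. (A i j - (if i = j then m else 0)) * u j) = 0" if "i < n" for i
  proof (rule psd_form_zero_imp_kernel[OF _ _ _ that])
    show "0 \<le> quad_form n (\<lambda>i j. A i j - (if i = j then m else 0)) y" for y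
      using min[of y] by (simp add: quad_form_shift m_def)
    show "quad_form n (\<lambda>i j. A i j - (if i = j then m else 0)) u = 0"
      using u by (simp add: quad_form_shift m_def)
  qed (use sym in auto)
  then have ker: "(\<Sum>j<n. A i j * u j) = m * u i" if "i < n" for i
    using that
    by (simp add: left_diff_distrib sum_subtractf if_distrib[of "\<lambda>z. z * _"] cong: if_cong)
  moreover have "\<exists>i<n. u i \<noteq> 0"
    using u by (metis (no_types, lifting) lessThan_iff power_zero_numeral sum.neutral zero_neq_one)
  ultimately have "eigenvalue ?A m"
    unfolding eigenvalue_mat_iff by blast
  then have "l \<le> m" by (rule ev)
  then have "l * (\<Sum>i<n. (x i)\<^sup>2) \<le> m * (\<Sum>i<n. (x i)\<^sup>2)"
    by (intro mult_right_mono sum_nonneg) auto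
  then show ?thesis using min[of x] by (simp add: m_def)
qed

text \<open>The lower bound applied to -A, whose eigenvalues are the negatives.\<close>

corollary eigenvalue_upper_bound_quad_form:
  fixes A :: "nat \<Rightarrow> nat \<Rightarrow> real"
  assumes "\<And>i j. i < n \<Longrightarrow> j < n \<Longrightarrow> A i j = A j i"
    and ev: "\<And>k. eigenvalue (Matrix.mat n n (\<lambda>(i, j). A i j)) k \<Longrightarrow> k \<le> l"
  shows "quad_form n A x \<le> l * (\<Sum>i<n. (x i)\<^sup>2)"
proof -
  have "- l \<le> k" if "eigenvalue (Matrix.mat n n (\<lambda>(i, j). - A i j)) k" for k
  proof -
    have "eigenvalue (Matrix.mat n n (\<lambda>(i, j). A i j)) (- k)"
      using that unfolding eigenvalue_mat_iff by (simp add: sum_negf minus_equation_iff) metis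
    from ev[OF this] show ?thesis by simp
  qed
  then have "- l * (\<Sum>i<n. (x i)\<^sup>2) \<le> quad_form n (\<lambda>i j. - A i j) x"
    using assms(1) by (intro eigenvalue_lower_bound_quad_form) auto
  then show ?thesis
    by (simp add: quad_form_def sum_negf)
qed

text \<open>At an eigenvector the form equals k |x|^2. In the main proof this ensures that
  \<open>sqrt lam\<close> squares to \<open>lam\<close>.\<close>

lemma eigenvalue_nonneg_if_psd:
  assumes "\<And>x. 0 \<le> quad_form n A x" and "eigenvalue (Matrix.mat n n (\<lambda>(i, j). A i j)) k"
  shows "0 \<le> k"
proof -
  obtain x where x: "\<exists>i<n. x i \<noteq> 0" "\<And>i. i < n \<Longrightarrow> (\<Sum>j<n. A i j * x j) = k * x i"
    using assms(2) unfolding eigenvalue_mat_iff by blast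
  have "quad_form n A x = (\<Sum>i<n. x i * (\<Sum>j<n. A i j * x j))"
    by (simp add: quad_form_def sum_distrib_left mult_ac)
  also have "\<dots> = k * (\<Sum>i<n. (x i)\<^sup>2)"
    using x(2) by (simp add: sum_distrib_left power2_eq_square mult_ac)
  finally have "0 \<le> k * (\<Sum>i<n. (x i)\<^sup>2)"
    using assms(1) by metis
  moreover have "0 < (\<Sum>i<n. (x i)\<^sup>2)"
    using x(1) by (auto intro!: sum_pos2)
  ultimately show ?thesis
    by (simp add: zero_le_mult_iff)
qed

section \<open>The Cramer-Wold device\<close>

text \<open>\<open>D\<close> is the law of \<open>X\<close> under the probability measure with
  density \<open>f / c\<close>. The phases 0 and -pi/2 turn the cosine into the real and imaginary
  parts of its characteristic function, so one family of cosine integrals determines it.\<close>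

lemma weighted_law:
  fixes f X :: "'a \<Rightarrow> real"
  assumes "prob_space M"
    and [measurable]: "X \<in> borel_measurable M" "f \<in> borel_measurable M"
    and f: "\<And>x. 0 \<le> f x" "\<And>x. f x \<le> C"
    and c: "c = (\<integral>x. f x \<partial>M)" "c \<noteq> 0"
  obtains D where "real_distribution D"
    and "\<And>s. char D s = Complex ((\<integral>x. f x * cos (s * X x + 0) \<partial>M) / c)
                              ((\<integral>x. f x * cos (s * X x + - pi / 2) \<partial>M) / c)"
    and "\<And>A. A \<in> sets borel \<Longrightarrow> measure D A = (\<integral>x. f x * indicator A (X x) \<partial>M) / c"
proof -
  interpret prob_space M by fact
  have int: "integrable M (\<lambda>x. f x * h x)" if [measurable]: "h \<in> borel_measurable M"
    and "\<And>x. \<bar>h x\<bar> \<le> 1" for h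
  proof (rule integrable_const_bound[of _ C])
    show "AE x in M. norm (f x * h x) \<le> C"
      using f that(2) by (auto simp: abs_mult intro!: AE_I2 intro: order_trans[OF mult_left_le])
  qed simp
  have "0 \<le> c" unfolding c(1) by (intro Bochner_Integration.integral_nonneg f)
  with c(2) have c0: "0 < c" by simp
  define Q where "Q = density M (\<lambda>x. f x / c)"
  have Q_int: "(\<integral>x. h x \<partial>Q) = (\<integral>x. (f x / c) *\<^sub>R h x \<partial>M)"
    if "h \<in> borel_measurable M" for h :: "'a \<Rightarrow> 'c::{banach, second_countable_topology}"
    unfolding Q_def using f c0 that by (intro integral_density) auto
  have "emeasure Q (space Q) = (\<integral>\<^sup>+x. ennreal (f x / c) \<partial>M)"
    unfolding Q_def by (simp add: emeasure_density cong: nn_integral_cong)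
  also have "\<dots> = ennreal (\<integral>x. f x / c \<partial>M)"
    using f c0 int[of "\<lambda>_. 1"] by (intro nn_integral_eq_integral) auto
  also have "\<dots> = 1"
    using c by simp
  finally interpret Q: prob_space Q by (rule prob_spaceI)
  have [measurable]: "X \<in> borel_measurable Q"
    unfolding Q_def by simp
  define D where "D = distr Q borel X"
  interpret D: prob_space D
    unfolding D_def by (rule Q.prob_space_distr) simp
  have "real_distribution D"
    by standard (auto simp: D_def)
  moreover have "char D s = Complex ((\<integral>x. f x * cos (s * X x + 0) \<partial>M) / c)
      ((\<integral>x. f x * cos (s * X x + - pi / 2) \<partial>M) / c)" for s
  proof -
    have sin: "cos (a + - pi / 2) = sin a" for a :: real
      by (simp add: cos_diff)
    have *: "char D s = (\<integral>x. (f x / c) *\<^sub>R iexp (s * X x) \<partial>M)"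
      unfolding char_def D_def by (subst integral_distr) (auto simp: Q_int)
    have i: "integrable M (\<lambda>x. (f x / c) *\<^sub>R iexp (s * X x))"
    proof (rule integrable_const_bound[of _ "C / c"])
      show "AE x in M. norm ((f x / c) *\<^sub>R iexp (s * X x)) \<le> C / c"
        using f c0 by (auto simp: divide_right_mono)
    qed simp
    show ?thesis
      unfolding * sin
      by (rule complex_eqI; simp only: complex.sel flip: integral_Re[OF i] integral_Im[OF i])
        (simp_all add: Re_exp Im_exp)
  qed
  moreover have "measure D A = (\<integral>x. f x * indicator A (X x) \<partial>M) / c"
    if [measurable]: "A \<in> sets borel" for A
  proof -
    have "measure D A = (\<integral>x. indicator A x \<partial>D)"
      by (simp add: D_def)
    also have "\<dots> = (\<integral>x. indicator A (X x) \<partial>Q)"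
      unfolding D_def by (subst integral_distr) auto
    finally show ?thesis
      by (simp add: Q_int)
  qed
  ultimately show thesis by (rule that)
qed

text \<open>Levy's uniqueness theorem for finite measures: divide both by their common mass and
  compare characteristic functions.\<close>

lemma weighted_law_eqI:
  fixes f X :: "'a \<Rightarrow> real" and g Y :: "'b \<Rightarrow> real"
  assumes M: "prob_space M" and N: "prob_space N"
    and X[measurable]: "X \<in> borel_measurable M" and f[measurable]: "f \<in> borel_measurable M"
    and Y[measurable]: "Y \<in> borel_measurable N" and g[measurable]: "g \<in> borel_measurable N"
    and fb: "\<And>x. 0 \<le> f x" "\<And>x. f x \<le> C" and gb: "\<And>y. 0 \<le> g y" "\<And>y. g y \<le> C"
    and eq: "\<And>s t. (\<integral>x. f x * cos (s * X x + t) \<partial>M) = (\<integral>y. g y * cos (s * Y y + t) \<partial>N)"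
    and A[measurable]: "A \<in> sets borel"
  shows "(\<integral>x. f x * indicator A (X x) \<partial>M) = (\<integral>y. g y * indicator A (Y y) \<partial>N)"
proof -
  interpret M: prob_space M by fact
  interpret N: prob_space N by fact
  define c where "c = (\<integral>x. f x \<partial>M)"
  \<comment> \<open>At \<open>s = t = 0\<close> the cosine is 1, so the two masses agree.\<close>
  have c': "c = (\<integral>y. g y \<partial>N)"
    using eq[of 0 0] by (simp add: c_def)
  have int: "integrable M f" "integrable N g"
    using fb gb by (auto intro!: M.integrable_const_bound[of _ C] N.integrable_const_bound[of _ C])
  show ?thesis
  proof (cases "c = 0")
    \<comment> \<open>Normalisation is impossible here, but both weights vanish almost
      everywhere.\<close>
    case True
    have "AE x in M. f x = 0" "AE y in N. g y = 0"
      using True c' integral_nonneg_eq_0_iff_AE[OF int(1)] integral_nonneg_eq_0_iff_AE[OF int(2)] fb gb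
      by (simp_all add: c_def)
    then have "AE x in M. f x * indicator A (X x) = 0" "AE y in N. g y * indicator A (Y y) = 0"
      by auto
    then show ?thesis
      by (simp add: integral_eq_zero_AE)
  next
    case False
    obtain D where D: "real_distribution D"
      "\<And>s. char D s = Complex ((\<integral>x. f x * cos (s * X x + 0) \<partial>M) / c)
                              ((\<integral>x. f x * cos (s * X x + - pi / 2) \<partial>M) / c)"
      "\<And>A. A \<in> sets borel \<Longrightarrow> measure D A = (\<integral>x. f x * indicator A (X x) \<partial>M) / c"
      using weighted_law[OF M X f fb c_def False] by blast
    obtain E where E: "real_distribution E"
      "\<And>s. char E s = Complex ((\<integral>x. g x * cos (s * Y x + 0) \<partial>N) / c)
                              ((\<integral>x. g x * cos (s * Y x + - pi / 2) \<partial>N) / c)"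
      "\<And>A. A \<in> sets borel \<Longrightarrow> measure E A = (\<integral>x. g x * indicator A (Y x) \<partial>N) / c"
      using weighted_law[OF N Y g gb c' False] by blast
    have "D = E"
      using D(1) E(1) by (rule Levy_uniqueness) (rule ext, simp only: D(2) E(2) eq)
    then show ?thesis
      using D(3)[OF A] E(3)[OF A] False by simp
  qed
qed

text \<open>The product formula cos a cos b = (cos (a + b) + cos (a - b)) / 2 splits the weighted
  integral into pieces with a single cosine, the shape of the induction hypothesis in
  \<open>box_cos_integral_eq\<close>.\<close>

lemma (in prob_space) expectation_cos_weight:
  fixes F S V :: "'a \<Rightarrow> real"
  assumes [measurable]: "F \<in> borel_measurable M" "S \<in> borel_measurable M" "V \<in> borel_measurable M"
    and F: "\<And>x. \<bar>F x\<bar> \<le> 1"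
  shows "(\<integral>x. F x * (1 + cos (S x + t)) * cos (s * V x + r) \<partial>M)
    = (\<integral>x. F x * cos (s * V x + r) \<partial>M)
      + (\<integral>x. F x * cos (s * V x + S x + (r + t)) \<partial>M) / 2
      + (\<integral>x. F x * cos (s * V x - S x + (r - t)) \<partial>M) / 2"
proof -
  have int: "integrable M (\<lambda>x. F x * cos (h x))" if [measurable]: "h \<in> borel_measurable M" for h
  proof (rule integrable_const_bound[of _ 1])
    show "AE x in M. norm (F x * cos (h x)) \<le> 1"
      using F by (auto simp: abs_mult intro!: AE_I2 mult_le_one)
  qed simp
  have "F x * (1 + cos (S x + t)) * cos (s * V x + r)
      = F x * cos (s * V x + r) + (F x * cos (s * V x + S x + (r + t)) / 2
        + F x * cos (s * V x - S x + (r - t)) / 2)" for x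
  proof -
    have "s * V x + S x + (r + t) = (s * V x + r) + (S x + t)"
      "s * V x - S x + (r - t) = (s * V x + r) - (S x + t)" by simp_all
    then show ?thesis
      by (simp only: cos_add[of "s * V x + r" "S x + t"] cos_diff[of "s * V x + r" "S x + t"])
        (simp add: field_simps)
  qed
  then show ?thesis
    by (simp add: int)
qed

text \<open>The coordinates are passed one at a time from the cosine to the indicators; the weight
  \<open>1 + cos\<close> is nonnegative, so that each step is an instance of Levy's uniqueness theorem
  for probability measures.\<close>

lemma box_cos_integral_eq:
  fixes X :: "nat \<Rightarrow> 'a \<Rightarrow> real" and Y :: "nat \<Rightarrow> 'b \<Rightarrow> real"
  assumes M: "prob_space M" and N: "prob_space N"
    and X[measurable]: "\<And>i. i < n \<Longrightarrow> X i \<in> borel_measurable M"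
    and Y[measurable]: "\<And>i. i < n \<Longrightarrow> Y i \<in> borel_measurable N"
    and law: "\<And>u. distr M borel (\<lambda>\<omega>. \<Sum>i<n. u i * X i \<omega>) = distr N borel (\<lambda>\<omega>. \<Sum>i<n. u i * Y i \<omega>)"
    and A[measurable]: "\<And>i. A i \<in> sets borel"
    and "k \<le> n"
  shows "(\<integral>\<omega>. (\<Prod>i<k. indicator (A i) (X i \<omega>)) * cos ((\<Sum>i=k..<n. u i * X i \<omega>) + t) \<partial>M)
    = (\<integral>\<omega>. (\<Prod>i<k. indicator (A i) (Y i \<omega>)) * cos ((\<Sum>i=k..<n. u i * Y i \<omega>) + t) \<partial>N)"
  using \<open>k \<le> n\<close>
proof (induction k arbitrary: u t)
  case 0
  have "(\<integral>\<omega>. cos ((\<Sum>i<n. u i * X i \<omega>) + t) \<partial>M)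
      = (\<integral>x. cos (x + t) \<partial>distr M borel (\<lambda>\<omega>. \<Sum>i<n. u i * X i \<omega>))"
    by (subst integral_distr) auto
  also have "\<dots> = (\<integral>\<omega>. cos ((\<Sum>i<n. u i * Y i \<omega>) + t) \<partial>N)"
    unfolding law by (subst integral_distr) auto
  finally show ?case
    by (simp add: atLeast0LessThan)
next
  case (Suc k)
  interpret M: prob_space M by fact
  interpret N: prob_space N by fact
  from Suc.prems have k: "k < n" "k \<le> n" by simp_all
  define F where "F \<omega> = (\<Prod>i<k. indicator (A i) (X i \<omega>) :: real)" for \<omega>
  define G where "G \<omega> = (\<Prod>i<k. indicator (A i) (Y i \<omega>) :: real)" for \<omega>
  define S where "S u \<omega> = (\<Sum>i=Suc k..<n. u i * X i \<omega>)" for u \<omega>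
  define T where "T u \<omega> = (\<Sum>i=Suc k..<n. u i * Y i \<omega>)" for u \<omega>
  have [measurable]: "X k \<in> borel_measurable M" "Y k \<in> borel_measurable N"
    using k by simp_all
  have [measurable]: "F \<in> borel_measurable M" "G \<in> borel_measurable N"
    unfolding F_def G_def using k by (auto intro!: borel_measurable_prod borel_measurable_indicator')
  have [measurable]: "S u \<in> borel_measurable M" "T u \<in> borel_measurable N" for u
    unfolding S_def T_def by (auto intro!: borel_measurable_sum borel_measurable_times)
  have F: "0 \<le> F \<omega>" "F \<omega> \<le> 1" for \<omega>
    unfolding F_def by (auto intro!: prod_nonneg prod_le_1 simp: indicator_def)
  have G: "0 \<le> G \<omega>" "G \<omega> \<le> 1" for \<omega>
    unfolding G_def by (auto intro!: prod_nonneg prod_le_1 simp: indicator_def)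
  have IH: "(\<integral>\<omega>. F \<omega> * cos (u k * X k \<omega> + S u \<omega> + t) \<partial>M)
      = (\<integral>\<omega>. G \<omega> * cos (u k * Y k \<omega> + T u \<omega> + t) \<partial>N)" for u t
    using Suc.IH[OF k(2), of u t] k(1)
    by (simp add: F_def G_def S_def T_def sum.atLeast_Suc_lessThan)
  \<comment> \<open>The three pieces are instances of \<open>IH\<close> with coefficient
    \<open>s\<close> at \<open>k\<close> and coefficients 0, \<open>u\<close> and \<open>-u\<close>
    at the later indices.\<close>
  have char_eq: "(\<integral>\<omega>. F \<omega> * (1 + cos (S u \<omega> + t)) * cos (s * X k \<omega> + r) \<partial>M)
      = (\<integral>\<omega>. G \<omega> * (1 + cos (T u \<omega> + t)) * cos (s * Y k \<omega> + r) \<partial>N)" for u t s r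
  proof -
    have "S (u(k := s)) = S u" "T (u(k := s)) = T u" for u
      by (auto simp: S_def T_def fun_eq_iff intro!: sum.cong)
    moreover have "S (\<lambda>i. - u i) \<omega> = - S u \<omega>" "T (\<lambda>i. - u i) \<eta> = - T u \<eta>" "S (\<lambda>i. 0) \<omega> = 0" "T (\<lambda>i. 0) \<eta> = 0" for \<omega> \<eta>
      by (simp_all add: S_def T_def sum_negf)
    ultimately show ?thesis
      using IH[of "(\<lambda>i. 0)(k := s)" r] IH[of "u(k := s)" "r + t"] IH[of "(\<lambda>i. - u i)(k := s)" "r - t"]
      using F G by (subst M.expectation_cos_weight N.expectation_cos_weight, simp_all)+
  qed
  have two: "1 + cos x \<le> 2" "0 \<le> 1 + cos x" for x :: real
    using cos_le_one[of x] cos_ge_minus_one[of x] by linarith+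
  have step: "(\<integral>\<omega>. F \<omega> * (1 + cos (S u \<omega> + t)) * indicator (A k) (X k \<omega>) \<partial>M)
      = (\<integral>\<omega>. G \<omega> * (1 + cos (T u \<omega> + t)) * indicator (A k) (Y k \<omega>) \<partial>N)" for u t
  proof (rule weighted_law_eqI[OF M N, where C = "1 * 2"])
    show "F \<omega> * (1 + cos (S u \<omega> + t)) \<le> 1 * 2" for \<omega>
      by (rule mult_mono[OF F(2) two(1)]) (simp_all only: two zero_le_one)
    show "0 \<le> F \<omega> * (1 + cos (S u \<omega> + t))" for \<omega>
      by (intro mult_nonneg_nonneg F two)
    show "G \<omega> * (1 + cos (T u \<omega> + t)) \<le> 1 * 2" for \<omega>
      by (rule mult_mono[OF G(2) two(1)]) (simp_all only: two zero_le_one)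
    show "0 \<le> G \<omega> * (1 + cos (T u \<omega> + t))" for \<omega>
      by (intro mult_nonneg_nonneg G two)
  qed (use char_eq in auto)
  have intM: "integrable M (\<lambda>\<omega>. F \<omega> * indicator (A k) (X k \<omega>) * h \<omega>)"
    if [measurable]: "h \<in> borel_measurable M" and "\<And>x. \<bar>h x\<bar> \<le> 1" for h
  proof (rule M.integrable_const_bound[of _ 1])
    show "AE x in M. norm (F x * indicator (A k) (X k x) * h x) \<le> 1"
      using F that(2) by (auto simp: abs_mult indicator_def intro!: AE_I2 mult_le_one)
  qed simp
  have intN: "integrable N (\<lambda>\<omega>. G \<omega> * indicator (A k) (Y k \<omega>) * h \<omega>)"
    if [measurable]: "h \<in> borel_measurable N" and "\<And>x. \<bar>h x\<bar> \<le> 1" for h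
  proof (rule N.integrable_const_bound[of _ 1])
    show "AE x in N. norm (G x * indicator (A k) (Y k x) * h x) \<le> 1"
      using G that(2) by (auto simp: abs_mult indicator_def intro!: AE_I2 mult_le_one)
  qed simp
  have "(\<integral>\<omega>. F \<omega> * (1 + cos (S u \<omega> + t)) * indicator (A k) (X k \<omega>) \<partial>M)
      = (\<integral>\<omega>. F \<omega> * indicator (A k) (X k \<omega>) * 1 \<partial>M)
        + (\<integral>\<omega>. F \<omega> * indicator (A k) (X k \<omega>) * cos (S u \<omega> + t) \<partial>M)" for u t
    by (subst Bochner_Integration.integral_add[symmetric], (rule intM; simp), (rule intM; simp))
      (rule Bochner_Integration.integral_cong, simp_all add: algebra_simps)
  moreover have "(\<integral>\<omega>. G \<omega> * (1 + cos (T u \<omega> + t)) * indicator (A k) (Y k \<omega>) \<partial>N)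
      = (\<integral>\<omega>. G \<omega> * indicator (A k) (Y k \<omega>) * 1 \<partial>N)
        + (\<integral>\<omega>. G \<omega> * indicator (A k) (Y k \<omega>) * cos (T u \<omega> + t) \<partial>N)" for u t
    by (subst Bochner_Integration.integral_add[symmetric], (rule intN; simp), (rule intN; simp))
      (rule Bochner_Integration.integral_cong, simp_all add: algebra_simps)
  \<comment> \<open>With zero coefficients and zero phase the weight \<open>1 + cos\<close> is the
    constant 2. This handles the summand 1, and subtracting it isolates the cosine.\<close>
  moreover have "(\<integral>\<omega>. F \<omega> * indicator (A k) (X k \<omega>) * 1 \<partial>M)
      = (\<integral>\<omega>. G \<omega> * indicator (A k) (Y k \<omega>) * 1 \<partial>N)"
    using step[of "\<lambda>_. 0" 0] by (simp add: S_def T_def mult.assoc mult.left_commute[of _ 2])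
  ultimately have "(\<integral>\<omega>. F \<omega> * indicator (A k) (X k \<omega>) * cos (S u \<omega> + t) \<partial>M)
      = (\<integral>\<omega>. G \<omega> * indicator (A k) (Y k \<omega>) * cos (T u \<omega> + t) \<partial>N)"
    using step[of u t] by simp
  then show ?case
    by (simp add: F_def G_def S_def T_def)
qed

lemma measure_box_eq_integral_prod:
  fixes n :: nat
  shows "measure M {\<omega> \<in> space M. \<forall>i<n. X i \<omega> \<in> A i} = (\<integral>\<omega>. (\<Prod>i<n. indicator (A i) (X i \<omega>)) \<partial>M)"
proof -
  have "(\<integral>\<omega>. (\<Prod>i<n. indicator (A i) (X i \<omega>)) \<partial>M)
      = (\<integral>\<omega>. indicator {\<omega> \<in> space M. \<forall>i<n. X i \<omega> \<in> A i} \<omega> \<partial>M :: real)"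
    by (intro Bochner_Integration.integral_cong)
      (auto simp: indicator_def intro!: prod.neutral prod_zero)
  also have "\<dots> = measure M ({\<omega> \<in> space M. \<forall>i<n. X i \<omega> \<in> A i} \<inter> space M)"
    by (rule Bochner_Integration.integral_indicator)
  finally show ?thesis
    by (simp add: Int_absorb2 subset_iff)
qed

text \<open>The case \<open>k = n\<close> of the preceding induction: every coordinate sits in an
  indicator and the cosine of the empty sum is 1.\<close>

theorem cramer_wold_boxes:
  fixes X :: "nat \<Rightarrow> 'a \<Rightarrow> real" and Y :: "nat \<Rightarrow> 'b \<Rightarrow> real"
  assumes "prob_space M" "prob_space N"
    and "\<And>i. i < n \<Longrightarrow> X i \<in> borel_measurable M"
    and "\<And>i. i < n \<Longrightarrow> Y i \<in> borel_measurable N"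
    and "\<And>u. distr M borel (\<lambda>\<omega>. \<Sum>i<n. u i * X i \<omega>) = distr N borel (\<lambda>\<omega>. \<Sum>i<n. u i * Y i \<omega>)"
    and "\<And>i. A i \<in> sets borel"
  shows "measure M {\<omega> \<in> space M. \<forall>i<n. X i \<omega> \<in> A i} = measure N {\<omega> \<in> space N. \<forall>i<n. Y i \<omega> \<in> A i}"
  using box_cos_integral_eq[OF assms order_refl, where u = "\<lambda>_. 0" and t = 0]
  unfolding measure_box_eq_integral_prod by simp

section \<open>Gaussian laws\<close>

abbreviation "std \<equiv> std_normal_distribution"

lemma prob_space_std: "prob_space std"
  using real_dist_normal_dist by (simp add: real_distribution_def)

lemma char_distr_scaled_std: "char (distr std borel (\<lambda>x. c * x)) s = exp (- ((s * c)\<^sup>2) / 2)"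
proof -
  have "char (distr std borel (\<lambda>x. c * x)) s = char std (s * c)"
    unfolding char_def by (subst integral_distr) (simp_all add: mult.assoc)
  then show ?thesis
    by (simp add: char_std_normal_distribution)
qed

text \<open>Writing the law as that of \<open>sqrt v * x\<close> covers \<open>v = 0\<close>, the
  point mass at 0, together with the nondegenerate normal laws.\<close>

lemma (in prob_space) distr_eq_scaled_stdI:
  assumes [measurable]: "Y \<in> borel_measurable M"
    and "\<And>s. (CLINT x|M. iexp (s * Y x)) = exp (- (s\<^sup>2 * v) / 2)" and "0 \<le> v"
  shows "distr M borel Y = distr std borel (\<lambda>x. sqrt v * x)"
proof (rule Levy_uniqueness)
  interpret S: prob_space std by (rule prob_space_std)
  show "real_distribution (distr M borel Y)"
    by (rule real_distribution_distr) simp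
  show "real_distribution (distr std borel (\<lambda>x. sqrt v * x))"
    by (rule S.real_distribution_distr) simp
  show "char (distr M borel Y) = char (distr std borel (\<lambda>x. sqrt v * x))"
  proof
    fix s
    have "char (distr M borel Y) s = (CLINT x|M. iexp (s * Y x))"
      unfolding char_def by (subst integral_distr) auto
    then show "char (distr M borel Y) s = char (distr std borel (\<lambda>x. sqrt v * x)) s"
      using assms(2)[of s] assms(3)
      unfolding char_distr_scaled_std by (simp add: power_mult_distrib)
  qed
qed

text \<open>The characteristic function exp (-s^2/2) is even.\<close>

lemma std_symmetric: "distr std borel uminus = std"
proof (rule Levy_uniqueness)
  interpret S: prob_space std by (rule prob_space_std)
  have "(uminus :: real \<Rightarrow> real) = (\<lambda>x. - 1 * x)" by auto
  then show "char (distr std borel uminus) = char std"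
    using char_distr_scaled_std[of "-1"] by (auto simp: char_std_normal_distribution)
  show "real_distribution (distr std borel uminus)"
    by (rule S.real_distribution_distr) simp
qed (rule real_dist_normal_dist)

lemma (in prob_space) centered_gaussian:
  assumes "gaussian_rv M Y" and mean: "expectation Y = 0"
  shows "integrable M (\<lambda>\<omega>. (Y \<omega>)\<^sup>2)"
    and "distr M borel Y = distr std borel (\<lambda>x. sqrt (expectation (\<lambda>\<omega>. (Y \<omega>)\<^sup>2)) * x)"
proof -
  have [measurable]: "Y \<in> borel_measurable M"
    using assms(1) by (simp add: gaussian_rv_def)
  have "integrable M (\<lambda>\<omega>. (Y \<omega>)\<^sup>2) \<and>
     distr M borel Y = distr std borel (\<lambda>x. sqrt (expectation (\<lambda>\<omega>. (Y \<omega>)\<^sup>2)) * x)"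
  proof -
    consider (normal) \<mu> \<sigma> where "0 < \<sigma>" "distributed M lborel Y (normal_density \<mu> \<sigma>)"
      | (const) \<mu> where "AE \<omega> in M. Y \<omega> = \<mu>"
      using assms(1) by (auto simp: gaussian_rv_def)
    then show ?thesis
    proof cases
      case normal
      then have [simp]: "\<mu> = 0"
        using normal_distributed_expectation[OF normal] mean by simp
      have var: "expectation (\<lambda>\<omega>. (Y \<omega>)\<^sup>2) = \<sigma>\<^sup>2"
        using normal_distributed_variance[OF normal] mean by simp
      \<comment> \<open>A function that is not integrable has Bochner integral 0, while this
        integral is positive.\<close>
      then have "integrable M (\<lambda>\<omega>. (Y \<omega>)\<^sup>2)"
        using normal(1) not_integrable_integral_eq by fastforce
      moreover have "distributed M lborel (\<lambda>\<omega>. Y \<omega> / \<sigma>) std_normal_density"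
        using normal_standard_normal_convert[OF normal(1), of Y 0] normal(2) by simp
      then have "distr M borel (\<lambda>\<omega>. Y \<omega> / \<sigma>) = std"
        by (simp add: distributed_def cong: distr_cong)
      then have "distr std borel (\<lambda>x. \<sigma> * x) = distr M borel Y"
        using normal(1) by (auto simp: distr_distr comp_def dest!: sym[of "distr M borel _"])
      ultimately show ?thesis
        using var normal(1) by simp
    next
      case const
      have "expectation Y = \<mu>"
        using const by (subst integral_cong_AE[of _ _ "\<lambda>_. \<mu>"]) (auto simp: prob_space)
      with const mean have Y0: "AE \<omega> in M. Y \<omega> = 0" by simp
      then have "expectation (\<lambda>\<omega>. (Y \<omega>)\<^sup>2) = 0"
        by (intro integral_eq_zero_AE) auto
      moreover have "integrable M (\<lambda>\<omega>. (Y \<omega>)\<^sup>2)"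
        using Y0 by (subst integrable_cong_AE[of _ _ "\<lambda>_. 0"]) auto
      moreover have "distr M borel Y = distr std borel (\<lambda>x. sqrt 0 * x)"
      proof (rule distr_eq_scaled_stdI)
        fix s
        have "(CLINT x|M. iexp (s * Y x)) = (CLINT x|M. 1)"
          using Y0 by (intro integral_cong_AE) auto
        then show "(CLINT x|M. iexp (s * Y x)) = exp (- (s\<^sup>2 * 0) / 2)"
          by (simp add: prob_space)
      qed auto
      ultimately show ?thesis by simp
    qed
  qed
  then show "integrable M (\<lambda>\<omega>. (Y \<omega>)\<^sup>2)"
    and "distr M borel Y = distr std borel (\<lambda>x. sqrt (expectation (\<lambda>\<omega>. (Y \<omega>)\<^sup>2)) * x)" by auto
qed

section \<open>Vectors of independent standard normal variables\<close>

abbreviation "std_vec n \<equiv> PiM {..<n::nat} (\<lambda>_. std)"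

lemma prob_space_std_vec: "prob_space (std_vec n)"
  by (intro prob_space_PiM prob_space_std)

lemma CLINT_std_vec:
  "(CLINT z|std_vec n. iexp (s * (\<Sum>k<n. b k * z k))) = exp (- (s\<^sup>2 * (\<Sum>k<n. (b k)\<^sup>2)) / 2)"
proof -
  interpret S: prob_space std by (rule prob_space_std)
  interpret P: product_sigma_finite "\<lambda>_::nat. std"
    by standard (rule S.sigma_finite_countable)
  have "(CLINT z|std_vec n. iexp (s * (\<Sum>k<n. b k * z k))) = (CLINT z|std_vec n. (\<Prod>k<n. iexp (s * b k * z k)))"
    by (simp add: sum_distrib_left exp_sum mult.assoc)
  also have "\<dots> = (\<Prod>k<n. CLINT x|std. iexp (s * b k * x))"
    by (intro P.product_integral_prod) (auto intro!: S.integrable_iexp simp flip: of_real_mult)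
  also have "\<dots> = (\<Prod>k<n. complex_of_real (exp (- ((s * b k)\<^sup>2) / 2)))"
    using fun_cong[OF char_std_normal_distribution] by (intro prod.cong refl) (simp only: char_def)
  also have "\<dots> = exp (\<Sum>k<n. - ((s * b k)\<^sup>2) / 2)"
    by (simp add: exp_sum flip: of_real_prod)
  also have "(\<Sum>k<n. - ((s * b k)\<^sup>2) / 2) = - (s\<^sup>2 * (\<Sum>k<n. (b k)\<^sup>2)) / 2"
    by (simp add: sum_distrib_left power_mult_distrib sum_divide_distrib sum_negf)
  finally show ?thesis .
qed

lemma distr_std_vec_linear:
  "distr (std_vec n) borel (\<lambda>z. \<Sum>k<n. b k * z k) = distr std borel (\<lambda>x. sqrt (\<Sum>k<n. (b k)\<^sup>2) * x)"
  by (rule prob_space.distr_eq_scaled_stdI[OF prob_space_std_vec])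
    (auto simp only: CLINT_std_vec intro!: sum_nonneg zero_le_power2, measurable)

lemma distr_std_vec_pair_linear:
  "distr (std_vec m \<Otimes>\<^sub>M std_vec n) borel (\<lambda>(z, g). (\<Sum>k<m. a k * z k) + (\<Sum>k<n. b k * g k))
   = distr std borel (\<lambda>x. sqrt ((\<Sum>k<m. (a k)\<^sup>2) + (\<Sum>k<n. (b k)\<^sup>2)) * x)"
proof -
  interpret P: prob_space "std_vec m" by (rule prob_space_std_vec)
  interpret Q: prob_space "std_vec n" by (rule prob_space_std_vec)
  interpret PQ: pair_prob_space "std_vec m" "std_vec n" ..
  have [measurable]: "(\<lambda>(z, g). (\<Sum>k<m. a k * z k) + (\<Sum>k<n. b k * g k)) \<in> borel_measurable (std_vec m \<Otimes>\<^sub>M std_vec n)"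
    unfolding split_beta by measurable
  show ?thesis
  proof (rule PQ.P.distr_eq_scaled_stdI)
    fix s
    let ?f = "\<lambda>p. iexp (s * (case p of (z, g) \<Rightarrow> (\<Sum>k<m. a k * z k) + (\<Sum>k<n. b k * g k)))"
    have "integrable (std_vec m \<Otimes>\<^sub>M std_vec n) ?f"
      by (rule PQ.P.integrable_iexp) auto
    then have "(CLINT p|std_vec m \<Otimes>\<^sub>M std_vec n. ?f p) = (CLINT z|std_vec m. CLINT g|std_vec n. ?f (z, g))"
      by (rule PQ.integral_fst'[symmetric])
    also have "\<dots> = (CLINT z|std_vec m. CLINT g|std_vec n. iexp (s * (\<Sum>k<m. a k * z k)) * iexp (s * (\<Sum>k<n. b k * g k)))"
      by (simp add: distrib_left exp_add)
    also have "\<dots> = (CLINT z|std_vec m. iexp (s * (\<Sum>k<m. a k * z k)) * complex_of_real (exp (- (s\<^sup>2 * (\<Sum>k<n. (b k)\<^sup>2)) / 2)))"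
      by (simp only: integral_mult_right_zero CLINT_std_vec)
    also have "\<dots> = complex_of_real (exp (- (s\<^sup>2 * (\<Sum>k<m. (a k)\<^sup>2)) / 2)) * complex_of_real (exp (- (s\<^sup>2 * (\<Sum>k<n. (b k)\<^sup>2)) / 2))"
      by (simp only: integral_mult_left_zero CLINT_std_vec)
    also have "\<dots> = exp (- (s\<^sup>2 * ((\<Sum>k<m. (a k)\<^sup>2) + (\<Sum>k<n. (b k)\<^sup>2))) / 2)"
      by (simp add: distrib_left diff_divide_distrib exp_add flip: of_real_mult exp_add)
    finally show "(CLINT p|std_vec m \<Otimes>\<^sub>M std_vec n. ?f p) = exp (- (s\<^sup>2 * ((\<Sum>k<m. (a k)\<^sup>2) + (\<Sum>k<n. (b k)\<^sup>2))) / 2)" .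
  qed (auto intro!: sum_nonneg add_nonneg_nonneg)
qed

section \<open>Tail and quantile estimates\<close>

lemma emeasure_std: "A \<in> sets borel \<Longrightarrow> emeasure std A = (\<integral>\<^sup>+x. ennreal (std_normal_density x) * indicator A x \<partial>lborel)"
  by (simp add: emeasure_density)

text \<open>\<open>- (x / (1 + x\<^sup>2)) \<phi>(x)\<close> has derivative \<open>\<phi>(x) (1 - 2 / (1 + x\<^sup>2)\<^sup>2) \<le> \<phi>(x)\<close>.\<close>

lemma std_tail_lower_bound:
  assumes "1 \<le> t"
  shows "t / (1 + t\<^sup>2) * std_normal_density t \<le> measure std {t..}"
proof -
  interpret S: prob_space std by (rule prob_space_std)
  define F where "F x = - (x / (1 + x\<^sup>2) * std_normal_density x)" for x
  define f where "f x = std_normal_density x * (1 - 2 / (1 + x\<^sup>2)\<^sup>2)" for x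
  have pos: "0 < 1 + x\<^sup>2" for x :: real
    by (simp add: add_pos_nonneg)
  have phi: "(std_normal_density has_real_derivative - x * std_normal_density x) (at x)" for x
  proof -
    have "((\<lambda>x. c * exp (- x\<^sup>2 / 2)) has_real_derivative - x * (c * exp (- x\<^sup>2 / 2))) (at x)" for c :: real
      by (auto intro!: derivative_eq_intros)
    then show ?thesis
      unfolding std_normal_density_def .
  qed
  have "(\<integral>\<^sup>+x. ennreal (f x) * indicator {t..} x \<partial>lborel) = ennreal (0 - F t)"
  proof (rule nn_integral_FTC_atLeast)
    show "f \<in> borel_measurable borel"
      unfolding f_def by measurable
    fix x :: real assume "t \<le> x"
    have nz: "1 + x\<^sup>2 \<noteq> 0" using pos[of x] by simp
    have q: "((\<lambda>x. x / (1 + x\<^sup>2)) has_real_derivative 2 / (1 + x\<^sup>2)\<^sup>2 - 1 / (1 + x\<^sup>2)) (at x)"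
    proof (rule derivative_eq_intros refl nz)+
      have "(a - 2 * (a - 1)) / (a * a) = 2 / a\<^sup>2 - 1 / a" if "a \<noteq> 0" for a :: real
        using that by (simp add: field_simps power2_eq_square)
      from this[OF nz] show "(1 * (1 + x\<^sup>2) - x * (0 + real 2 * (1 * x ^ (2 - Suc 0)))) / ((1 + x\<^sup>2) * (1 + x\<^sup>2))
          = 2 / (1 + x\<^sup>2)\<^sup>2 - 1 / (1 + x\<^sup>2)"
        by (simp add: power2_eq_square)
    qed
    have "- (c * (2 / a\<^sup>2 - 1 / a) + - x * c * (x / a)) = c * (1 - 2 / a\<^sup>2)"
      if "a = 1 + x\<^sup>2" "a \<noteq> 0" for a c :: real
    proof -
      have "- (c * (2 / a\<^sup>2 - 1 / a) + - x * c * (x / a)) = c * ((1 + x\<^sup>2) / a - 2 / a\<^sup>2)"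
        by (simp add: algebra_simps power2_eq_square add_divide_distrib)
      then show ?thesis using that by simp
    qed
    from this[OF refl nz, of "std_normal_density x"]
    show "(F has_real_derivative f x) (at x)"
      using DERIV_minus[OF DERIV_mult[OF q phi[of x]]] unfolding F_def f_def by (simp add: mult_ac)
    \<comment> \<open>From 1 on, \<open>f\<close> is nonnegative, as the fundamental theorem for
      nonnegative integrals demands.\<close>
    have "1 \<le> x\<^sup>2" using assms \<open>t \<le> x\<close> by simp
    then have "2\<^sup>2 \<le> (1 + x\<^sup>2)\<^sup>2" by (intro power_mono) auto
    then have "2 / (1 + x\<^sup>2)\<^sup>2 \<le> 1" by (simp add: divide_le_eq)
    then show "0 \<le> f x" unfolding f_def by simp
  next
    show "(F \<longlongrightarrow> 0) at_top"
      unfolding F_def std_normal_density_def by real_asymp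
  qed
  moreover have "(\<integral>\<^sup>+x. ennreal (f x) * indicator {t..} x \<partial>lborel) \<le> emeasure std {t..}"
    unfolding emeasure_std[OF borel_closed[OF closed_atLeast]]
    by (intro nn_integral_mono mult_right_mono ennreal_leI)
      (auto simp: f_def intro!: mult_left_le)
  ultimately show ?thesis
    by (simp add: F_def S.emeasure_eq_measure)
qed

text \<open>By symmetry the two closed half-lines have equal mass, and together they cover the
  line.\<close>

lemma std_nonneg_half: "1 / 2 \<le> measure std {0..}"
proof -
  interpret S: prob_space std by (rule prob_space_std)
  have "measure std {..0} = measure (distr std borel uminus) {..0}"
    by (simp only: std_symmetric)
  also have "\<dots> = measure std (uminus -` {..0} \<inter> space std)"
    by (rule measure_distr) auto
  also have "uminus -` {..0} \<inter> space std = {0::real..}"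
    by auto
  finally have "measure std {..0} = measure std {0..}" .
  moreover have "measure std ({..0} \<union> {0..}) \<le> measure std {..0} + measure std {0..}"
    by (rule measure_Un_le) auto
  moreover have "{..0} \<union> {0..} = space std" by auto
  ultimately show ?thesis
    using S.prob_space by simp
qed

text \<open>The quartile estimate requires sqrt (2 pi) to be at most 4 (0.68 - 0.68^3 / 6), about
  2.5104; the bound 2.51 just suffices.\<close>

lemma sqrt_2pi_bounds: "2 < sqrt (2 * pi)" "sqrt (2 * pi) < 2.51"
proof -
  show "2 < sqrt (2 * pi)"
    using pi_approx(1) by (intro real_less_rsqrt) simp
  show "sqrt (2 * pi) < 2.51"
    using pi_approx(2) by (intro real_less_lsqrt) (simp_all add: power2_eq_square)
qed

text \<open>Half of the mass lies on the nonnegative axis. On [-0.68, 0] the inequality exp y >= 1 +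
  y bounds the density below by a polynomial whose integral slightly exceeds 1/4.\<close>

lemma std_quartile: "3 / 4 \<le> measure std {-0.68..}"
proof -
  interpret S: prob_space std by (rule prob_space_std)
  define F where "F x = (x - x ^ 3 / 6) / sqrt (2 * pi)" for x :: real
  define f where "f x = (1 - x\<^sup>2 / 2) / sqrt (2 * pi)" for x :: real
  have "(\<integral>\<^sup>+x. ennreal (f x) * indicator {-0.68..0} x \<partial>lborel) = ennreal (F 0 - F (-0.68))"
  proof (rule nn_integral_FTC_Icc)
    show "f \<in> borel_measurable borel"
      unfolding f_def by measurable
    fix x :: real assume x: "x \<in> {-0.68..0}"
    show "(F has_real_derivative f x) (at x)"
      unfolding F_def f_def by (auto intro!: derivative_eq_intros simp: field_simps)
    have "x\<^sup>2 \<le> 1" using x by (simp add: abs_square_le_1)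
    then show "0 \<le> f x" unfolding f_def by simp
  qed simp
  \<comment> \<open>The endpoint 0 is a null set; removing it makes the interval disjoint from the
    half-line \<open>{0..}\<close>.\<close>
  moreover have "(\<integral>\<^sup>+x. ennreal (f x) * indicator {-0.68..0} x \<partial>lborel) = (\<integral>\<^sup>+x. ennreal (f x) * indicator {-0.68..<0} x \<partial>lborel)"
    using AE_lborel_singleton[of 0] by (intro nn_integral_cong_AE, eventually_elim) (auto simp: indicator_def)
  moreover have "(\<integral>\<^sup>+x. ennreal (f x) * indicator {-0.68..<0} x \<partial>lborel) \<le> emeasure std {-0.68..<0}"
  proof -
    have "f x \<le> std_normal_density x" for x
      using exp_ge_add_one_self[of "- (x\<^sup>2) / 2"]
      by (simp add: f_def std_normal_density_def divide_right_mono)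
    then show ?thesis
      by (subst emeasure_std) (auto intro!: nn_integral_mono mult_right_mono ennreal_leI)
  qed
  ultimately have "ennreal (F 0 - F (-0.68)) \<le> emeasure std {-0.68..<0}"
    by metis
  then have "F 0 - F (-0.68) \<le> measure std {-0.68..<0}"
    by (simp add: S.emeasure_eq_measure)
  moreover have "1 / 4 \<le> F 0 - F (-0.68)"
    using sqrt_2pi_bounds by (simp add: F_def field_simps eval_nat_numeral)
  moreover have "measure std ({-0.68..<0} \<union> {0..}) = measure std {-0.68..<0} + measure std {0..}"
    by (rule S.finite_measure_Union) auto
  moreover have "{-0.68..<0} \<union> {0..} = {-0.68::real..}" by auto
  ultimately show ?thesis
    using std_nonneg_half by simp
qed

text \<open>If x >= -0.68 then s x >= -0.68 s >= -0.68 c. The degenerate law \<open>s = 0\<close> is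
  included.\<close>

lemma scaled_std_ge_threequarters:
  assumes "0 \<le> s" "s \<le> c"
  shows "3 / 4 \<le> measure (distr std borel (\<lambda>x. s * x)) {- 0.68 * c..}"
proof -
  interpret S: prob_space std by (rule prob_space_std)
  have "s * -0.68 \<le> s * x" if "-0.68 \<le> x" for x
    using that assms by (intro mult_left_mono)
  then have "{-0.68..} \<subseteq> (\<lambda>x. s * x) -` {- 0.68 * c..}"
    using assms by fastforce
  then have "measure std {-0.68..} \<le> measure std ((\<lambda>x. s * x) -` {- 0.68 * c..} \<inter> space std)"
    by (intro S.finite_measure_mono) (auto intro!: measurable_sets_borel[of _ borel])
  then show ?thesis
    using std_quartile by (subst measure_distr) auto
qed

text \<open>The complement is the box on which every coordinate is below \<open>t\<close>, and its
  product measure factorises.\<close>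

lemma measure_std_vec_max_ge:
  "measure (std_vec n) {z \<in> space (std_vec n). \<exists>i<n. t \<le> z i} = 1 - (1 - measure std {t..}) ^ n"
proof -
  interpret S: prob_space std by (rule prob_space_std)
  interpret P: finite_product_prob_space "\<lambda>_. std" "{..<n}"
    by standard (auto intro: S.prob_space)
  have "measure (std_vec n) (\<Pi>\<^sub>E i\<in>{..<n}. {..<t}) = (\<Prod>i<n. measure std {..<t})"
    by (rule P.prob_times) auto
  also have "measure std {..<t} = 1 - measure std {t..}"
  proof -
    have "{..<t} = space std - {t..}" by auto
    then show ?thesis using S.prob_compl[of "{t..}"] by simp
  qed
  finally have "measure (std_vec n) (\<Pi>\<^sub>E i\<in>{..<n}. {..<t}) = (1 - measure std {t..}) ^ n"
    by simp
  moreover have "{z \<in> space (std_vec n). \<exists>i<n. t \<le> z i} = space (std_vec n) - (\<Pi>\<^sub>E i\<in>{..<n}. {..<t})"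
  proof (intro equalityI subsetI)
    fix z assume "z \<in> {z \<in> space (std_vec n). \<exists>i<n. t \<le> z i}"
    then obtain i where z: "z \<in> space (std_vec n)" and i: "i < n" "t \<le> z i" by blast
    have "z \<notin> (\<Pi>\<^sub>E i\<in>{..<n}. {..<t})"
      using i PiE_mem[of z "{..<n}" "\<lambda>_. {..<t}" i] by auto
    with z show "z \<in> space (std_vec n) - (\<Pi>\<^sub>E i\<in>{..<n}. {..<t})" by simp
  next
    fix z assume z: "z \<in> space (std_vec n) - (\<Pi>\<^sub>E i\<in>{..<n}. {..<t})"
    \<comment> \<open>Membership in \<open>PiE\<close> also demands extensionality, which every
      point of the product space has.\<close>
    then have "z \<in> extensional {..<n}"
      by (simp add: space_PiM PiE_iff)
    with z have "\<not> (\<forall>i<n. z i < t)"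
      by (auto simp: PiE_iff)
    with z show "z \<in> {z \<in> space (std_vec n). \<exists>i<n. t \<le> z i}"
      by (simp add: not_less)
  qed
  moreover have "(\<Pi>\<^sub>E i\<in>{..<n}. {..<t}) \<in> sets (std_vec n)"
    by (intro sets_PiM_I_finite) auto
  ultimately show ?thesis
    by (simp add: P.prob_compl)
qed

section \<open>Explicit numerical estimates behind the constants\<close>

lemma exp_ge_sum5:
  fixes x :: real
  assumes "0 \<le> x"
  shows "(\<Sum>k\<le>5. x ^ k / fact k) \<le> exp x"
proof -
  have "(\<Sum>k\<le>5. x ^ k /\<^sub>R fact k) \<le> exp x"
    unfolding exp_def using assms
    by (intro sum_le_suminf summable_exp_generic) auto
  then show ?thesis by (simp add: divide_inverse mult.commute)
qed

lemma exp_numeric_bounds: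
  "exp (4.2::real) \<le> 70" "5.98 \<le> exp (1.8::real)" "3 \<le> exp (1.1::real)" "3.48 \<le> exp (1.25::real)"
proof -
  \<comment> \<open>Since 4.2 = 21 * 0.2, a bound for \<open>exp 0.2\<close> is enough. Bounding the
    remainder by \<open>exp 0.2\<close> itself gives a linear inequality that is solved for
    \<open>exp 0.2\<close>.\<close>
  obtain t :: real where "\<bar>t\<bar> \<le> \<bar>0.2\<bar>"
    and t: "exp (0.2::real) = (\<Sum>m<3. 0.2 ^ m / fact m) + exp t / fact 3 * 0.2 ^ 3"
    using Maclaurin_exp_le by blast
  then have "exp t \<le> exp 0.2" by (subst exp_le_cancel_iff) simp
  with t have "exp (0.2::real) \<le> 1.222"
    by (simp add: eval_nat_numeral)
  then have "exp (0.2::real) ^ 21 \<le> 1.222 ^ 21"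
    by (intro power_mono) auto
  also have "exp (0.2::real) ^ 21 = exp 4.2"
    by (simp flip: exp_of_nat_mult)
  also have "1.222 ^ 21 \<le> (70::real)"
    by (simp add: power_divide)
  finally show "exp (4.2::real) \<le> 70" .
  \<comment> \<open>Degree 5 is the first at which the Taylor sums reach these values.\<close>
  show "5.98 \<le> exp (1.8::real)" "3 \<le> exp (1.1::real)" "3.48 \<le> exp (1.25::real)"
    by (rule order_trans[OF _ exp_ge_sum5]; simp add: eval_nat_numeral)+
qed

lemma threshold_bounds:
  fixes n :: nat
  assumes "70 \<le> n"
  defines "L \<equiv> 2 * ln (real n) - 2.5"
  shows "0 < L" "4 \<le> L - ln L" "L - ln L \<le> L"
proof -
  have "4.2 \<le> ln (70::real)"
    using exp_numeric_bounds(1) by (subst ln_ge_iff) auto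
  also have "\<dots> \<le> ln n" using assms(1) by simp
  finally have L: "5.9 \<le> L" by (simp add: L_def)
  then show "0 < L" "L - ln L \<le> L" by simp_all
  \<comment> \<open>The tangent to the logarithm at \<open>exp 1.8\<close>, about 6.05, is used
    because \<open>L\<close> can be as small as 5.9.\<close>
  have "ln L = 1.8 + ln (L / exp 1.8)"
    using L by (simp add: ln_div)
  also have "\<dots> \<le> 0.8 + L / exp 1.8"
    using ln_le_minus_one[of "L / exp 1.8"] L by simp
  also have "\<dots> \<le> 0.8 + L / 5.98"
    using exp_numeric_bounds(2) L by (intro add_left_mono divide_left_mono) auto
  finally show "4 \<le> L - ln L" using L by simp
qed

text \<open>The threshold is tuned so that \<open>n\<close> times the density at \<open>t\<close> is
  exactly \<open>exp 1.25 * sqrt L / sqrt (2 * pi)\<close>. As \<open>t\<close> is at most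
  \<open>sqrt L\<close>, the Mills bound leaves only the factor t^2 / (1 + t^2), which is at least
  4/5. Finally (1 - p)^n <= exp (-n p).\<close>

lemma n_tail_bound:
  fixes n :: nat
  assumes "70 \<le> n"
  defines "L \<equiv> 2 * ln (real n) - 2.5"
  defines "t \<equiv> sqrt (L - ln L)"
  shows "(1 - measure std {t..}) ^ n \<le> 1 / 3"
proof -
  interpret S: prob_space std by (rule prob_space_std)
  have L: "0 < L" "4 \<le> L - ln L" "L - ln L \<le> L"
    using threshold_bounds[OF assms(1)] by (simp_all add: L_def)
  have t2: "t\<^sup>2 = L - ln L"
    using L by (simp add: t_def)
  have t: "2 \<le> t"
    unfolding t_def using L by (intro real_le_rsqrt) simp
  define p where "p = measure std {t..}"
  have n0: "0 < real n" using assms(1) by simp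
  have "exp (- (t\<^sup>2) / 2) = exp 1.25 * sqrt L / n"
  proof -
    have "- (t\<^sup>2) / 2 = 1.25 + ln L / 2 - ln n"
      unfolding t2 by (simp add: L_def field_simps)
    then show ?thesis
      using L n0 by (simp add: exp_add exp_diff ln_sqrt[symmetric])
  qed
  then have phi: "n * std_normal_density t = exp 1.25 * sqrt L / sqrt (2 * pi)"
    using n0 by (simp add: std_normal_density_def)
  have "t \<le> sqrt L"
    unfolding t_def using L by simp
  \<comment> \<open>The factors bound \<open>exp 1.25\<close> from below,
    \<open>sqrt (2 * pi)\<close> from above and t^2 / (1 + t^2) from below; 1.1 is a round number
    above ln 3.\<close>
  have "1.1 \<le> 3.48 / 2.51 * (4 / 5 :: real)" by simp
  also have "\<dots> \<le> exp 1.25 / sqrt (2 * pi) * (t\<^sup>2 / (1 + t\<^sup>2))"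
  proof (rule mult_mono)
    show "3.48 / 2.51 \<le> exp 1.25 / sqrt (2 * pi)"
      using exp_numeric_bounds(4) sqrt_2pi_bounds by (intro frac_le) auto
    have "4 \<le> t\<^sup>2" using L t2 by simp
    then show "4 / 5 \<le> t\<^sup>2 / (1 + t\<^sup>2)" by (simp add: field_simps)
  qed auto
  also have "\<dots> \<le> exp 1.25 / sqrt (2 * pi) * (t * sqrt L / (1 + t\<^sup>2))"
    using t \<open>t \<le> sqrt L\<close> by (intro mult_left_mono divide_right_mono) (auto simp: power2_eq_square)
  also have "\<dots> = n * (t / (1 + t\<^sup>2) * std_normal_density t)"
    by (simp only: mult.left_commute[of "real n"] phi) (simp add: mult_ac)
  also have "\<dots> \<le> n * p"
    unfolding p_def using std_tail_lower_bound[of t] t by (intro mult_left_mono) auto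
  finally have np: "1.1 \<le> n * p" .
  have "(1 - p) ^ n \<le> exp (- p) ^ n"
    unfolding p_def using exp_ge_add_one_self[of "- measure std {t..}"]
    by (intro power_mono) auto
  also have "\<dots> = exp (- (n * p))"
    by (simp flip: exp_of_nat_mult)
  also have "\<dots> \<le> exp (- 1.1)"
    using np by simp
  also have "\<dots> = 1 / exp 1.1"
    by (subst exp_minus) (rule inverse_eq_divide)
  also have "\<dots> \<le> 1 / 3"
    using exp_numeric_bounds(3) by (intro divide_left_mono) auto
  finally show ?thesis unfolding p_def .
qed

section \<open>The maximum\<close>

lemma borel_measurable_std_vec_pair:
  assumes "i < n"
  shows "(\<lambda>p. a * fst p i + (\<Sum>k<n. b k * snd p k)) \<in> borel_measurable (std_vec n \<Otimes>\<^sub>M std_vec n)"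
proof -
  have "(\<lambda>z. z i) \<in> measurable (std_vec n) std"
    using assms by (intro measurable_component_singleton) simp
  then have "(\<lambda>z. z i) \<in> borel_measurable (std_vec n)"
    by simp
  then have "(\<lambda>p. fst p i) \<in> borel_measurable (std_vec n \<Otimes>\<^sub>M std_vec n)"
    by (rule measurable_compose[OF measurable_fst])
  moreover have "(\<lambda>p. \<Sum>k<n. b k * snd p k) \<in> borel_measurable (std_vec n \<Otimes>\<^sub>M std_vec n)"
  proof (rule measurable_compose[OF measurable_snd])
    show "(\<lambda>g. \<Sum>k<n. b k * g k) \<in> borel_measurable (std_vec n)"
      by measurable
  qed
  ultimately show ?thesis
    by measurable
qed

lemma std_mixture_max_ge:
  fixes n :: nat and B :: "nat \<Rightarrow> nat \<Rightarrow> real"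
  assumes "70 \<le> n" "0 \<le> l"
    and B: "\<And>i. i < n \<Longrightarrow> (\<Sum>k<n. (B i k)\<^sup>2) \<le> V"
  defines "t \<equiv> sqrt (2 * ln (real n) - 2.5 - ln (2 * ln (real n) - 2.5))"
  defines "N \<equiv> std_vec n \<Otimes>\<^sub>M std_vec n"
  shows "1 / 2 \<le> measure N {p \<in> space N. \<exists>i<n. sqrt l * t - 0.68 * sqrt V \<le> sqrt l * fst p i + (\<Sum>k<n. B i k * snd p k)}"
proof -
  interpret P: prob_space "std_vec n" by (rule prob_space_std_vec)
  interpret PP: pair_prob_space "std_vec n" "std_vec n" ..
  define E where "E = {p \<in> space N. \<exists>i<n. sqrt l * t - 0.68 * sqrt V \<le> sqrt l * fst p i + (\<Sum>k<n. B i k * snd p k)}"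
  have [measurable]: "(\<lambda>p. sqrt l * fst p i + (\<Sum>k<n. B i k * snd p k)) \<in> borel_measurable N" if "i < n" for i
    unfolding N_def using that by (rule borel_measurable_std_vec_pair)
  have "E = (\<Union>i<n. {p \<in> space N. sqrt l * t - 0.68 * sqrt V \<le> sqrt l * fst p i + (\<Sum>k<n. B i k * snd p k)})"
    unfolding E_def by auto
  also have "\<dots> \<in> sets N"
    by (intro sets.finite_UN) auto
  finally have E: "E \<in> sets (std_vec n \<Otimes>\<^sub>M std_vec n)"
    unfolding N_def .
  define Z where "Z = {z \<in> space (std_vec n). \<exists>i<n. t \<le> z i}"
  have Z: "Z \<in> sets (std_vec n)"
  proof -
    have "Z = (\<Union>i<n. {z \<in> space (std_vec n). t \<le> z i})"
      unfolding Z_def by auto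
    also have "\<dots> \<in> sets (std_vec n)"
      by (intro sets.finite_UN) auto
    finally show ?thesis .
  qed
  \<comment> \<open>For each fixed \<open>z\<close> in \<open>Z\<close> any index \<open>i\<close>
    with \<open>t \<le> z i\<close> will do. Working with sections, the choice of \<open>i\<close>
    is made pointwise and the integration over \<open>z\<close> comes afterwards.\<close>
  have section_ge: "ennreal (3 / 4) * indicator Z z \<le> emeasure (std_vec n) (Pair z -` E)" for z
  proof (cases "z \<in> Z")
    case True
    then obtain i where z: "z \<in> space (std_vec n)" and i: "i < n" "t \<le> z i"
      unfolding Z_def by blast
    let ?W = "\<lambda>g. \<Sum>k<n. B i k * g k"
    have [measurable]: "?W \<in> borel_measurable (std_vec n)"
      by measurable
    have "3 / 4 \<le> measure (distr (std_vec n) borel ?W) {- 0.68 * sqrt V..}"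
      unfolding distr_std_vec_linear using B[OF i(1)]
      by (intro scaled_std_ge_threequarters) (auto intro!: sum_nonneg)
    also have "\<dots> = measure (std_vec n) (?W -` {- 0.68 * sqrt V..} \<inter> space (std_vec n))"
      by (intro measure_distr) auto
    also have "\<dots> \<le> measure (std_vec n) (Pair z -` E)"
    proof (rule P.finite_measure_mono)
      have "sqrt l * t \<le> sqrt l * z i"
        using i(2) \<open>0 \<le> l\<close> by (intro mult_left_mono) auto
      then show "?W -` {- 0.68 * sqrt V..} \<inter> space (std_vec n) \<subseteq> Pair z -` E"
        using z i(1) by (fastforce simp: E_def N_def space_pair_measure)
      show "Pair z -` E \<in> sets (std_vec n)"
        by (rule sets_Pair1[OF E])
    qed
    finally show ?thesis
      using True by (simp add: P.emeasure_eq_measure)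
  qed simp
  have "(1 - measure std {t..}) ^ n \<le> 1 / 3"
    unfolding t_def by (rule n_tail_bound) fact
  then have "2 / 3 \<le> measure (std_vec n) Z"
    unfolding Z_def measure_std_vec_max_ge by simp
  then have "ennreal (3 / 4 * (2 / 3)) \<le> ennreal (3 / 4 * measure (std_vec n) Z)"
    by (intro ennreal_leI mult_left_mono) auto
  also have "\<dots> = (\<integral>\<^sup>+z. ennreal (3 / 4) * indicator Z z \<partial>std_vec n)"
    using Z by (subst nn_integral_cmult_indicator) (auto simp: P.emeasure_eq_measure simp flip: ennreal_mult)
  also have "\<dots> \<le> (\<integral>\<^sup>+z. emeasure (std_vec n) (Pair z -` E) \<partial>std_vec n)"
    by (intro nn_integral_mono section_ge)
  also have "\<dots> = emeasure N E"
    unfolding N_def by (rule P.emeasure_pair_measure_alt[OF E, symmetric])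
  also have "\<dots> = ennreal (measure N E)"
    unfolding N_def by (rule PP.P.emeasure_eq_measure)
  finally have "3 / 4 * (2 / 3) \<le> measure N E"
    by (subst (asm) ennreal_le_iff) auto
  then show ?thesis
    unfolding E_def by simp
qed

lemma (in prob_space) second_moment_linear_combination:
  assumes "jointly_gaussian M {..<n} X"
    and mean: "\<And>i. i < n \<Longrightarrow> expectation (X i) = 0"
  shows "expectation (\<lambda>\<omega>. (\<Sum>i<n. u i * X i \<omega>)\<^sup>2) = quad_form n (\<lambda>i j. covariance M (X i) (X j)) u"
    and "expectation (\<lambda>\<omega>. \<Sum>i<n. u i * X i \<omega>) = 0"
proof -
  have g: "gaussian_rv M (X i)" if "i < n" for i
    using assms(1)[unfolded jointly_gaussian_def, rule_format, of "{i}" "\<lambda>_. 1"] that by simp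
  then have meas: "X i \<in> borel_measurable M" if "i < n" for i
    using that by (auto simp: gaussian_rv_def)
  have sq: "integrable M (\<lambda>\<omega>. (X i \<omega>)\<^sup>2)" if "i < n" for i
    using centered_gaussian(1)[OF g mean] that by blast
  have int: "integrable M (X i)" if "i < n" for i
    using square_integrable_imp_integrable[OF meas sq] that by blast
  \<comment> \<open>Without integrability the Bochner integrals would default to 0 and the expansion
    of the square would fail. Square integrability of the coordinates supplies it.\<close>
  have prod: "integrable M (\<lambda>\<omega>. X i \<omega> * X j \<omega>)" if "i < n" "j < n" for i j
  proof (rule Bochner_Integration.integrable_bound)
    show "integrable M (\<lambda>\<omega>. (X i \<omega>)\<^sup>2 + (X j \<omega>)\<^sup>2)"
      using sq that by simp
    show "(\<lambda>\<omega>. X i \<omega> * X j \<omega>) \<in> borel_measurable M"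
      using meas that by simp
    have "\<bar>x * y\<bar> \<le> x\<^sup>2 + y\<^sup>2" for x y :: real
    proof -
      have "0 \<le> \<bar>x\<bar> * \<bar>y\<bar>" "2 * (\<bar>x\<bar> * \<bar>y\<bar>) \<le> x\<^sup>2 + y\<^sup>2"
        using sum_squares_bound[of "\<bar>x\<bar>" "\<bar>y\<bar>"] by (simp_all add: mult.assoc)
      then show ?thesis unfolding abs_mult by linarith
    qed
    then show "AE \<omega> in M. norm (X i \<omega> * X j \<omega>) \<le> norm ((X i \<omega>)\<^sup>2 + (X j \<omega>)\<^sup>2)"
      by simp
  qed
  have "(\<Sum>i<n. u i * X i \<omega>)\<^sup>2 = (\<Sum>i<n. \<Sum>j<n. u i * u j * (X i \<omega> * X j \<omega>))" for \<omega>
    by (simp add: power2_eq_square sum_product mult_ac)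
  then have "expectation (\<lambda>\<omega>. (\<Sum>i<n. u i * X i \<omega>)\<^sup>2)
      = expectation (\<lambda>\<omega>. \<Sum>i<n. \<Sum>j<n. u i * u j * (X i \<omega> * X j \<omega>))"
    by simp
  also have "\<dots> = (\<Sum>i<n. expectation (\<lambda>\<omega>. \<Sum>j<n. u i * u j * (X i \<omega> * X j \<omega>)))"
    by (intro Bochner_Integration.integral_sum Bochner_Integration.integrable_sum
        integrable_mult_right prod) auto
  also have "\<dots> = (\<Sum>i<n. \<Sum>j<n. expectation (\<lambda>\<omega>. u i * u j * (X i \<omega> * X j \<omega>)))"
    by (intro sum.cong refl Bochner_Integration.integral_sum integrable_mult_right prod) auto
  also have "\<dots> = quad_form n (\<lambda>i j. covariance M (X i) (X j)) u"
    using mean by (simp add: quad_form_def covariance_def mult_ac)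
  finally show "expectation (\<lambda>\<omega>. (\<Sum>i<n. u i * X i \<omega>)\<^sup>2) = quad_form n (\<lambda>i j. covariance M (X i) (X j)) u" .
  show "expectation (\<lambda>\<omega>. \<Sum>i<n. u i * X i \<omega>) = 0"
    by (simp add: int mean)
qed

text \<open>Passing to the complement turns the event about the maximum into a box, the form to
  which \<open>cramer_wold_boxes\<close> applies.\<close>

lemma (in prob_space) prob_exists_ge_eq:
  fixes W :: "nat \<Rightarrow> 'a \<Rightarrow> real"
  assumes [measurable]: "\<And>i. i < n \<Longrightarrow> W i \<in> borel_measurable M"
  shows "prob {\<omega> \<in> space M. \<exists>i<n. c \<le> W i \<omega>} = 1 - prob {\<omega> \<in> space M. \<forall>i<n. W i \<omega> \<in> {..<c}}"
proof -
  have "{\<omega> \<in> space M. \<exists>i<n. c \<le> W i \<omega>} = (\<Union>i<n. {\<omega> \<in> space M. c \<le> W i \<omega>})"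
    by auto
  also have "\<dots> \<in> events"
    by (intro sets.finite_UN) auto
  finally have "prob (space M - {\<omega> \<in> space M. \<exists>i<n. c \<le> W i \<omega>}) = 1 - prob {\<omega> \<in> space M. \<exists>i<n. c \<le> W i \<omega>}"
    by (rule prob_compl)
  moreover have "space M - {\<omega> \<in> space M. \<exists>i<n. c \<le> W i \<omega>} = {\<omega> \<in> space M. \<forall>i<n. W i \<omega> \<in> {..<c}}"
    by (auto simp: not_le)
  ultimately show ?thesis by simp
qed

theorem mainTheorem2:
  fixes M :: "'a measure" and n :: nat and X :: "nat \<Rightarrow> 'a \<Rightarrow> real" and lam Lam :: real
  assumes "prob_space M"
    and "n \<ge> 70"
    and "jointly_gaussian M {..<n} X"
    and "\<And>i. i < n \<Longrightarrow> (\<integral>\<omega>. X i \<omega> \<partial>M) = 0"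
    and "min_eigenvalue (covariance_matrix M n X) lam"
    and "max_eigenvalue (covariance_matrix M n X) Lam"
  shows "\<P>(\<omega> in M. Max ((\<lambda>i. X i \<omega>) ` {..<n}) \<ge>
            sqrt lam * sqrt (2 * ln (real n) - 2.5 - ln (2 * ln (real n) - 2.5)) - 0.68 * sqrt Lam)
         \<ge> 1 / 2"
proof -
  interpret prob_space M by fact
  define C where "C i j = covariance M (X i) (X j)" for i j
  let ?C = "Matrix.mat n n (\<lambda>(i, j). C i j)"
  have sym: "C i j = C j i" for i j
    by (simp add: C_def covariance_def mult.commute)
  have second_moment: "expectation (\<lambda>\<omega>. (\<Sum>i<n. u i * X i \<omega>)\<^sup>2) = quad_form n C u" for u
    unfolding C_def[abs_def] by (rule second_moment_linear_combination(1)[OF assms(3,4)])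
  have psd: "0 \<le> quad_form n C u" for u
    unfolding second_moment[symmetric] by simp
  have lam: "eigenvalue ?C lam" "\<And>k. eigenvalue ?C k \<Longrightarrow> lam \<le> k"
    and Lam: "\<And>k. eigenvalue ?C k \<Longrightarrow> k \<le> Lam"
    using assms(5,6)
    by (auto simp: min_eigenvalue_def max_eigenvalue_def covariance_matrix_def C_def)
  have lam0: "0 \<le> lam"
    by (rule eigenvalue_nonneg_if_psd[OF psd lam(1)])
  have diag: "C i i \<le> Lam" if "i < n" for i
  proof -
    \<comment> \<open>The unit vector e_i tests the upper eigenvalue bound: the form takes the value
      \<open>C i i\<close> there.\<close>
    let ?e = "\<lambda>j. if j = i then 1 else (0::real)"
    have "(\<Sum>j<n. (?e j)\<^sup>2) = (\<Sum>j<n. ?e j)"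
      by (intro sum.cong) auto
    moreover have "quad_form n C ?e = (\<Sum>j<n. \<Sum>k<n. if k = i then if j = i then C i i else 0 else 0)"
      unfolding quad_form_def by (intro sum.cong) auto
    ultimately show ?thesis
      using eigenvalue_upper_bound_quad_form[of n C Lam ?e] sym Lam that by simp
  qed
  have "C i j - (if i = j then lam else 0) = C j i - (if j = i then lam else 0)" for i j
    using sym by simp
  moreover have "0 \<le> quad_form n (\<lambda>i j. C i j - (if i = j then lam else 0)) x" for x
    using eigenvalue_lower_bound_quad_form[of n C lam x] sym lam(2) by (simp add: quad_form_shift)
  ultimately obtain B where B: "\<And>i j. i < n \<Longrightarrow> j < n \<Longrightarrow> C i j - (if i = j then lam else 0) = (\<Sum>k<n. B i k * B j k)"
    using psd_imp_gram[of n "\<lambda>i j. C i j - (if i = j then lam else 0)"] by blast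
  have B_row: "(\<Sum>k<n. (B i k)\<^sup>2) \<le> Lam" if "i < n" for i
    using B[OF that that] diag[OF that] lam0 by (simp add: power2_eq_square)

  define N where "N = std_vec n \<Otimes>\<^sub>M std_vec n"
  interpret P: prob_space "std_vec n" by (rule prob_space_std_vec)
  interpret PP: pair_prob_space "std_vec n" "std_vec n" ..
  have N: "prob_space N"
    unfolding N_def by (rule PP.P.prob_space_axioms)
  \<comment> \<open>The pair \<open>p\<close> holds the independent vectors Z and G, so the
    covariance of \<open>Y\<close> is lam I + B B^T = C.\<close>
  define Y where "Y i p = sqrt lam * fst p i + (\<Sum>k<n. B i k * snd p k)" for i and p :: "(nat \<Rightarrow> real) \<times> (nat \<Rightarrow> real)"
  have X_meas: "X i \<in> borel_measurable M" if "i < n" for i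
    using assms(3)[unfolded jointly_gaussian_def, rule_format, of "{i}" "\<lambda>_. 1"] that
    by (simp add: gaussian_rv_def)
  have Y_meas: "Y i \<in> borel_measurable N" if "i < n" for i
    unfolding Y_def N_def using that by (rule borel_measurable_std_vec_pair)
  \<comment> \<open>Both combinations are centred Gaussian, possibly degenerate, with variance lam
    |u|^2 + |B^T u|^2.\<close>
  have law: "distr M borel (\<lambda>\<omega>. \<Sum>i<n. u i * X i \<omega>) = distr N borel (\<lambda>p. \<Sum>i<n. u i * Y i p)" for u
  proof -
    have "gaussian_rv M (\<lambda>\<omega>. \<Sum>i<n. u i * X i \<omega>)"
      using assms(3) by (auto simp: jointly_gaussian_def)
    from centered_gaussian(2)[OF this second_moment_linear_combination(2)[OF assms(3,4)]]
    have "distr M borel (\<lambda>\<omega>. \<Sum>i<n. u i * X i \<omega>) = distr std borel (\<lambda>x. sqrt (quad_form n C u) * x)"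
      unfolding second_moment .
    also have "quad_form n C u = (\<Sum>k<n. (sqrt lam * u k)\<^sup>2) + (\<Sum>k<n. (\<Sum>i<n. u i * B i k)\<^sup>2)"
      using quad_form_shift[of n C lam u] quad_form_gram[OF B, where x = u] lam0
      by (simp add: power_mult_distrib sum_distrib_left)
    also have "distr std borel (\<lambda>x. sqrt \<dots> * x)
        = distr N borel (\<lambda>(z, g). (\<Sum>k<n. sqrt lam * u k * z k) + (\<Sum>k<n. (\<Sum>i<n. u i * B i k) * g k))"
      unfolding N_def by (rule distr_std_vec_pair_linear[symmetric])
    also have "(\<lambda>(z, g). (\<Sum>k<n. sqrt lam * u k * z k) + (\<Sum>k<n. (\<Sum>i<n. u i * B i k) * g k))
        = (\<lambda>p. \<Sum>i<n. u i * Y i p)"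
    proof
      fix p :: "(nat \<Rightarrow> real) \<times> (nat \<Rightarrow> real)"
      have "(\<Sum>k<n. (\<Sum>i<n. u i * B i k) * snd p k) = (\<Sum>i<n. u i * (\<Sum>k<n. B i k * snd p k))"
        unfolding sum_distrib_left sum_distrib_right by (subst sum.swap) (simp add: mult_ac)
      then show "(case p of (z, g) \<Rightarrow> (\<Sum>k<n. sqrt lam * u k * z k) + (\<Sum>k<n. (\<Sum>i<n. u i * B i k) * g k))
          = (\<Sum>i<n. u i * Y i p)"
        by (simp add: split_beta Y_def distrib_left sum.distrib mult_ac)
    qed
    finally show ?thesis .
  qed

  define c where "c = sqrt lam * sqrt (2 * ln (real n) - 2.5 - ln (2 * ln (real n) - 2.5)) - 0.68 * sqrt Lam"
  have "1 / 2 \<le> measure N {p \<in> space N. \<exists>i<n. c \<le> Y i p}"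
    unfolding N_def Y_def c_def by (rule std_mixture_max_ge[OF assms(2) lam0 B_row])
  also have "\<dots> = 1 - measure N {p \<in> space N. \<forall>i<n. Y i p \<in> {..<c}}"
    by (rule prob_space.prob_exists_ge_eq[OF N Y_meas])
  \<comment> \<open>Here the estimate passes from the model \<open>Y\<close> to the given
    \<open>X\<close>.\<close>
  also have "\<dots> = 1 - measure M {\<omega> \<in> space M. \<forall>i<n. X i \<omega> \<in> {..<c}}"
    using cramer_wold_boxes[OF \<open>prob_space M\<close> N X_meas Y_meas law, of "\<lambda>_. {..<c}"] by simp
  also have "\<dots> = measure M {\<omega> \<in> space M. \<exists>i<n. c \<le> X i \<omega>}"
    by (rule prob_exists_ge_eq[OF X_meas, symmetric])
  also have "{\<omega> \<in> space M. \<exists>i<n. c \<le> X i \<omega>} = {\<omega> \<in> space M. c \<le> Max ((\<lambda>i. X i \<omega>) ` {..<n})}"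
    using assms(2) by (subst Max_ge_iff) (auto simp: lessThan_empty_iff)
  finally show ?thesis
    unfolding c_def .
qed

end
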